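(* Let $E$ and $F$ be Banach lattices. For an operator $T : E \to F$, the following statements are equivalent: (1) $T$ is order L-weakly compact. (2) For every disjoint sequence $(f_n)$ of $B_{F'}$ we have $|T'(f_n)| \to 0$ for the topology $\sigma(E',E)$. (3) For every order bounded sequence $(x_n)$ of $E$ and every disjoint sequence $(f_n)$ of $B_{F'}$ we have $f_n(T(x_n)) \to 0$.
   Context: All Banach lattices are real; "operator" means bounded linear map; $G'$ denotes the topological dual (a Banach lattice when $G$ is one), $T' : F' \to E'$ the adjoint of $T$, and $B_G$ the closed unit ball of $G$. A nonempty bounded subset $A$ of a Banach lattice $G$ is L-weakly compact if $\lim\|x_n\|=0$ for every disjoint sequence $(x_n)$ in the solid hull of $A$. An operator $T : E \to F$ between Banach lattices is order L-weakly compact if $T[0,x]$ is an L-weakly compact subset of $F$ for each $x\in E^+$. $\sigma(E',E)$ is the weak-star topology on $E'$. *)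

theory Defs
  imports "HOL-Analysis.Analysis" "HOL-Library.Lattice_Algebras"
begin

section \<open>Banach lattices\<close>

class banach_lattice = banach + ordered_real_vector + lattice_ab_group_add_abs +
  assumes norm_mono_abs: "\<bar>x\<bar> \<le> \<bar>y\<bar> \<Longrightarrow> norm x \<le> norm y"

text \<open>
  The dual \<open>'a \<Rightarrow>\<^sub>L real\<close> is made an instance of \<^class>\<open>banach_lattice\<close>. Class instances can constrain
  the arguments of a type constructor only by sorts, so the role of the scalars is played by the
  following class, which describes the Banach lattice of real numbers and has \<^typ>\<open>real\<close> as
  its only intended instance.
\<close>

class real_scalar = banach_lattice + conditionally_complete_lattice + real_normed_algebra_1 +
  assumes abs_eq_norm: "\<bar>x\<bar> = norm x *\<^sub>R 1"

instance real :: real_scalar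
  by standard auto

section \<open>The dual Banach lattice\<close>

lemma real_scalar_one_nonneg: "(0::'a::real_scalar) \<le> 1"
proof -
  have "\<bar>1::'a\<bar> = 1" using abs_eq_norm[of "1::'a"] by simp
  then show ?thesis by (metis abs_ge_zero)
qed

lemma real_scalar_le_norm:
  fixes x :: "'a::real_scalar"
  assumes "norm x \<le> r" shows "x \<le> r *\<^sub>R 1"
proof -
  have "x \<le> \<bar>x\<bar>" by (rule abs_ge_self)
  also have "\<dots> \<le> r *\<^sub>R 1"
    unfolding abs_eq_norm using assms real_scalar_one_nonneg by (rule scaleR_right_mono)
  finally show ?thesis .
qed

lemma real_scalar_norm_le:
  fixes x :: "'a::real_scalar"
  assumes "x \<le> r *\<^sub>R 1" "- x \<le> r *\<^sub>R 1" "0 \<le> r"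
  shows "norm x \<le> r"
proof -
  have "\<bar>x\<bar> \<le> r *\<^sub>R 1" using assms by (simp add: abs_le_iff)
  moreover have "\<bar>r *\<^sub>R (1::'a)\<bar> = r *\<^sub>R 1"
    using assms(3) real_scalar_one_nonneg by (intro abs_of_nonneg scaleR_nonneg_nonneg)
  ultimately have "norm x \<le> norm (r *\<^sub>R (1::'a))" by (intro norm_mono_abs) simp
  then show ?thesis using assms(3) by simp
qed

lemma norm_abs_lattice: "norm \<bar>x\<bar> = norm (x::'a::banach_lattice)"
  by (intro order.antisym norm_mono_abs) auto

lemma norm_mono_nonneg: "norm x \<le> norm (y::'a::banach_lattice)" if "0 \<le> x" "x \<le> y"
  using that by (intro norm_mono_abs) (auto simp: abs_of_nonneg)

lemma norm_pprt: "norm (pprt x) \<le> norm (x::'a::banach_lattice)"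
proof -
  have "norm (pprt x) \<le> norm \<bar>x\<bar>"
    by (rule norm_mono_nonneg) (auto simp: abs_prts)
  then show ?thesis by (simp add: norm_abs_lattice)
qed

lemma norm_nprt: "norm (nprt x) \<le> norm (x::'a::banach_lattice)"
  using norm_pprt[of "-x"] by (simp add: pprt_neg)

instantiation blinfun :: (banach_lattice, real_scalar) ordered_real_vector
begin

definition less_eq_blinfun :: "'a \<Rightarrow>\<^sub>L 'b \<Rightarrow> 'a \<Rightarrow>\<^sub>L 'b \<Rightarrow> bool"
  where "f \<le> g \<longleftrightarrow> (\<forall>x\<ge>0. blinfun_apply f x \<le> blinfun_apply g x)"

definition less_blinfun :: "'a \<Rightarrow>\<^sub>L 'b \<Rightarrow> 'a \<Rightarrow>\<^sub>L 'b \<Rightarrow> bool"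
  where "f < g \<longleftrightarrow> f \<le> g \<and> \<not> g \<le> f" for f g :: "'a \<Rightarrow>\<^sub>L 'b"

instance
proof
  fix f g h :: "'a \<Rightarrow>\<^sub>L 'b" and a b :: real
  show "f < g \<longleftrightarrow> f \<le> g \<and> \<not> g \<le> f" by (rule less_blinfun_def)
  show "f \<le> f" by (simp add: less_eq_blinfun_def)
  show "f \<le> h" if "f \<le> g" "g \<le> h"
    using that by (fastforce simp: less_eq_blinfun_def)
  show "f = g" if "f \<le> g" "g \<le> f"
  proof (rule blinfun_eqI)
    fix x :: 'a
    have eq: "f y = g y" if "0 \<le> y" for y
      using \<open>f \<le> g\<close> \<open>g \<le> f\<close> that by (auto simp: less_eq_blinfun_def intro: order.antisym)
    have x: "x = pprt x - (- nprt x)" using prts[of x] by simp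
    have "f (pprt x) = g (pprt x)" "f (- nprt x) = g (- nprt x)"
      by (rule eq; simp)+
    then show "f x = g x" by (subst (1 2) x) (simp only: blinfun.diff_right)
  qed
  show "h + f \<le> h + g" if "f \<le> g"
    using that by (simp add: less_eq_blinfun_def blinfun.add_left)
  show "a *\<^sub>R f \<le> a *\<^sub>R g" if "f \<le> g" "0 \<le> a"
    using that by (simp add: less_eq_blinfun_def blinfun.scaleR_left scaleR_left_mono)
  show "a *\<^sub>R f \<le> b *\<^sub>R f" if "a \<le> b" "0 \<le> f"
    using that by (simp add: less_eq_blinfun_def blinfun.scaleR_left scaleR_right_mono)
qed

end

text \<open>The Riesz-Kantorovich formula for the positive part of a functional, on the positive cone.\<close>

definition rk_pos :: "('a::banach_lattice \<Rightarrow>\<^sub>L 'b::real_scalar) \<Rightarrow> 'a \<Rightarrow> 'b"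
  where "rk_pos f x = (SUP y\<in>{0..x}. blinfun_apply f y)"

lemma rk_bound:
  fixes f :: "'a::banach_lattice \<Rightarrow>\<^sub>L 'b::real_scalar"
  assumes "y \<in> {0..x}" shows "f y \<le> (norm f * norm x) *\<^sub>R 1"
proof (rule real_scalar_le_norm)
  have "norm (f y) \<le> norm f * norm y" by (rule norm_blinfun)
  also have "\<dots> \<le> norm f * norm x" using assms by (auto intro!: mult_left_mono norm_mono_nonneg)
  finally show "norm (f y) \<le> norm f * norm x" .
qed

lemma rk_bdd: "bdd_above (blinfun_apply f ` {0..x})"
  for f :: "'a::banach_lattice \<Rightarrow>\<^sub>L 'b::real_scalar"
  by (rule bdd_aboveI[where M="(norm f * norm x) *\<^sub>R 1"]) (use rk_bound in blast)

lemma rk_upper: "y \<in> {0..x} \<Longrightarrow> blinfun_apply f y \<le> rk_pos f x"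
  unfolding rk_pos_def by (rule cSUP_upper[OF _ rk_bdd])

lemma rk_least: "0 \<le> x \<Longrightarrow> (\<And>y. y \<in> {0..x} \<Longrightarrow> blinfun_apply f y \<le> z) \<Longrightarrow> rk_pos f x \<le> z"
  unfolding rk_pos_def by (rule cSUP_least) auto

lemma rk_nonneg: "0 \<le> x \<Longrightarrow> 0 \<le> rk_pos f x"
  using rk_upper[of 0 x f] by simp

lemma rk_norm: 
  assumes "0 \<le> x" shows "norm (rk_pos f x) \<le> norm f * norm x"
proof (rule real_scalar_norm_le)
  show "rk_pos f x \<le> (norm f * norm x) *\<^sub>R 1" using assms rk_bound by (rule rk_least)
  have "- rk_pos f x \<le> 0" using rk_nonneg[OF assms] by simp
  also have "0 \<le> (norm f * norm x) *\<^sub>R (1::'b)"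
    using real_scalar_one_nonneg by (intro scaleR_nonneg_nonneg) auto
  finally show "- rk_pos f x \<le> (norm f * norm x) *\<^sub>R 1" .
qed simp

lemma rk_add:
  assumes x: "0 \<le> x" and z: "0 \<le> z"
  shows "rk_pos f (x + z) = rk_pos f x + rk_pos f z"
proof (rule order.antisym)
  show "rk_pos f (x + z) \<le> rk_pos f x + rk_pos f z"
  proof (rule rk_least)
    fix y assume y: "y \<in> {0..x + z}"
    have 1: "inf y x \<in> {0..x}" using x y by auto
    have "y - inf y x = sup 0 (y - x)"
      by (simp add: add_sup_distrib_left)
    also have "\<dots> \<in> {0..z}" using y z by (auto simp: algebra_simps)
    finally have 2: "y - inf y x \<in> {0..z}" .
    have "f y = f (inf y x) + f (y - inf y x)" by (simp only: blinfun.diff_right) simp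
    also have "\<dots> \<le> rk_pos f x + rk_pos f z" using rk_upper[OF 1] rk_upper[OF 2] by (rule add_mono)
    finally show "f y \<le> rk_pos f x + rk_pos f z" .
  qed (use x z in simp)
  have "rk_pos f x \<le> rk_pos f (x + z) - rk_pos f z"
  proof (rule rk_least[OF x])
    fix y assume y: "y \<in> {0..x}"
    have "rk_pos f z \<le> rk_pos f (x + z) - f y"
    proof (rule rk_least[OF z])
      fix w assume w: "w \<in> {0..z}"
      have "f (y + w) \<le> rk_pos f (x + z)" using y w by (intro rk_upper) (auto intro: add_mono)
      then show "f w \<le> rk_pos f (x + z) - f y" by (simp add: blinfun.add_right algebra_simps)
    qed
    then show "f y \<le> rk_pos f (x + z) - rk_pos f z" by (simp add: algebra_simps)
  qed
  then show "rk_pos f x + rk_pos f z \<le> rk_pos f (x + z)" by (simp add: algebra_simps)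
qed

lemma rk_scale:
  assumes x: "0 \<le> x" and c: "0 \<le> c"
  shows "rk_pos f (c *\<^sub>R x) = c *\<^sub>R rk_pos f x"
proof (cases "c = 0")
  case True
  then show ?thesis by (simp add: rk_pos_def)
next
  case False
  have le: "rk_pos f (d *\<^sub>R u) \<le> d *\<^sub>R rk_pos f u" if "0 \<le> u" "0 < d" for d u
  proof (rule rk_least)
    fix y assume y: "y \<in> {0..d *\<^sub>R u}"
    have "(1/d) *\<^sub>R y \<le> (1/d) *\<^sub>R (d *\<^sub>R u)" using y that by (intro scaleR_left_mono) auto
    then have "(1/d) *\<^sub>R y \<in> {0..u}" using y that by (auto simp: scaleR_nonneg_nonneg)
    then have "d *\<^sub>R f ((1/d) *\<^sub>R y) \<le> d *\<^sub>R rk_pos f u"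
      using that by (intro scaleR_left_mono rk_upper) auto
    then show "f y \<le> d *\<^sub>R rk_pos f u" using that by (simp add: blinfun.scaleR_right)
  qed (use that in \<open>simp add: scaleR_nonneg_nonneg\<close>)
  have "rk_pos f ((1/c) *\<^sub>R (c *\<^sub>R x)) \<le> (1/c) *\<^sub>R rk_pos f (c *\<^sub>R x)"
    using x c False by (intro le) (auto simp: scaleR_nonneg_nonneg)
  then have "c *\<^sub>R rk_pos f ((1/c) *\<^sub>R (c *\<^sub>R x)) \<le> c *\<^sub>R (1/c) *\<^sub>R rk_pos f (c *\<^sub>R x)"
    using c by (rule scaleR_left_mono)
  then have "c *\<^sub>R rk_pos f x \<le> rk_pos f (c *\<^sub>R x)" using False by simp
  with le[OF x, of c] c False show ?thesis by (intro order.antisym) auto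
qed

lift_definition blinfun_pos :: "('a::banach_lattice \<Rightarrow>\<^sub>L 'b::real_scalar) \<Rightarrow> 'a \<Rightarrow>\<^sub>L 'b"
  is "\<lambda>f x. rk_pos f (pprt x) - rk_pos f (- nprt x)"
proof -
  fix f :: "'a \<Rightarrow>\<^sub>L 'b"
  define h where "h = (\<lambda>x. rk_pos f (pprt x) - rk_pos f (- nprt x))"
  have h: "h (a - b) = rk_pos f a - rk_pos f b" if "0 \<le> a" "0 \<le> b" for a b :: 'a
  proof -
    have "pprt (a - b) + b = a + (- nprt (a - b))"
      using prts[of "a - b"] by (simp add: algebra_simps)
    then have "rk_pos f (pprt (a - b)) + rk_pos f b = rk_pos f a + rk_pos f (- nprt (a - b))"
      using that by (simp flip: rk_add)
    then show ?thesis by (simp add: h_def algebra_simps)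
  qed
  have "bounded_linear h"
  proof (rule bounded_linear_intro[where K="2 * norm f"])
    fix x y :: 'a
    have "x + y = (pprt x + pprt y) - (- nprt x + - nprt y)"
      by (subst (1) prts[of x], subst (1) prts[of y]) (simp only: diff_conv_add_uminus minus_add_distrib minus_minus ac_simps)
    then have "h (x + y) = rk_pos f (pprt x + pprt y) - rk_pos f (- nprt x + - nprt y)"
      by (metis h add_nonneg_nonneg neg_0_le_iff_le nprt_le_zero zero_le_pprt)
    also have "\<dots> = h x + h y" by (subst (1 2) rk_add) (auto simp: h_def)
    finally show "h (x + y) = h x + h y" .
  next
    fix r :: real and x :: 'a
    have pos: "h (r *\<^sub>R x) = r *\<^sub>R h x" if "0 \<le> r" for r :: real and x :: 'a
    proof -
      have "r *\<^sub>R x = r *\<^sub>R pprt x - r *\<^sub>R (- nprt x)"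
        by (metis diff_minus_eq_add minus_minus prts scaleR_right_diff_distrib)
      then have "h (r *\<^sub>R x) = rk_pos f (r *\<^sub>R pprt x) - rk_pos f (r *\<^sub>R (- nprt x))"
        using that by (metis h neg_0_le_iff_le nprt_le_zero scaleR_nonneg_nonneg zero_le_pprt)
      also have "\<dots> = r *\<^sub>R h x"
        using that by (subst (1 2) rk_scale) (auto simp: h_def scaleR_right_diff_distrib)
      finally show ?thesis .
    qed
    have neg: "h (- x) = - h x" for x :: 'a by (simp add: h_def pprt_neg nprt_neg)
    show "h (r *\<^sub>R x) = r *\<^sub>R h x"
    proof (cases "0 \<le> r")
      case False
      then have "h ((- r) *\<^sub>R x) = (- r) *\<^sub>R h x" by (intro pos) simp
      then show ?thesis by (simp add: neg)
    qed (rule pos)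
  next
    fix x :: 'a
    have "norm (h x) \<le> norm (rk_pos f (pprt x)) + norm (rk_pos f (- nprt x))"
      unfolding h_def by (rule norm_triangle_ineq4)
    also have "\<dots> \<le> norm f * norm (pprt x) + norm f * norm (- nprt x)"
      by (intro add_mono rk_norm) auto
    also have "\<dots> \<le> norm f * norm x + norm f * norm x"
      using norm_pprt[of x] norm_nprt[of x] by (intro add_mono mult_left_mono) auto
    finally show "norm (h x) \<le> norm x * (2 * norm f)" by (simp add: algebra_simps)
  qed
  then show "bounded_linear (\<lambda>x. rk_pos f (pprt x) - rk_pos f (- nprt x))" by (simp add: h_def)
qed

lemma blinfun_pos_apply: "0 \<le> x \<Longrightarrow> blinfun_apply (blinfun_pos f) x = rk_pos f x"
  by transfer (simp add: rk_pos_def)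

lemma blinfun_pos_ge: "f \<le> blinfun_pos f"
  by (auto simp: less_eq_blinfun_def blinfun_pos_apply intro: rk_upper)

lemma blinfun_pos_nonneg: "0 \<le> blinfun_pos f"
  by (auto simp: less_eq_blinfun_def blinfun_pos_apply intro: rk_nonneg)

lemma blinfun_pos_least:
  assumes "f \<le> g" "0 \<le> g" shows "blinfun_pos f \<le> g"
  unfolding less_eq_blinfun_def
proof (intro allI impI)
  fix x :: 'a assume x: "0 \<le> x"
  have "f y \<le> g x" if "y \<in> {0..x}" for y
  proof -
    have "f y \<le> g y" using assms(1) that by (simp add: less_eq_blinfun_def)
    also have "0 \<le> g (x - y)" using assms(2) that by (simp add: less_eq_blinfun_def)
    then have "g y \<le> g x" by (simp add: blinfun.diff_right)
    finally show ?thesis .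
  qed
  then show "blinfun_pos f x \<le> g x" using x by (simp only: blinfun_pos_apply) (rule rk_least)
qed

instantiation blinfun :: (banach_lattice, real_scalar) banach_lattice
begin

definition sup_blinfun :: "'a \<Rightarrow>\<^sub>L 'b \<Rightarrow> 'a \<Rightarrow>\<^sub>L 'b \<Rightarrow> 'a \<Rightarrow>\<^sub>L 'b"
  where "sup f g = g + blinfun_pos (f - g)"

definition inf_blinfun :: "'a \<Rightarrow>\<^sub>L 'b \<Rightarrow> 'a \<Rightarrow>\<^sub>L 'b \<Rightarrow> 'a \<Rightarrow>\<^sub>L 'b"
  where "inf f g = f - blinfun_pos (f - g)"

definition abs_blinfun :: "'a \<Rightarrow>\<^sub>L 'b \<Rightarrow> 'a \<Rightarrow>\<^sub>L 'b"
  where "\<bar>f\<bar> = sup f (- f)" for f :: "'a \<Rightarrow>\<^sub>L 'b"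

instance
proof
  fix f g h :: "'a \<Rightarrow>\<^sub>L 'b"
  show "f \<le> sup f g" using blinfun_pos_ge[of "f - g"] by (simp add: sup_blinfun_def algebra_simps)
  show "g \<le> sup f g" using blinfun_pos_nonneg[of "f - g"] by (simp add: sup_blinfun_def)
  show "sup g h \<le> f" if "g \<le> f" "h \<le> f"
    using blinfun_pos_least[of "g - h" "f - h"] that by (simp add: sup_blinfun_def algebra_simps)
  show "inf f g \<le> g" using blinfun_pos_ge[of "f - g"] by (simp add: inf_blinfun_def algebra_simps)
  show "inf f g \<le> f" using blinfun_pos_nonneg[of "f - g"] by (simp add: inf_blinfun_def)
  show "f \<le> inf g h" if "f \<le> g" "f \<le> h"
    using blinfun_pos_least[of "g - h" "g - f"] that by (simp add: inf_blinfun_def algebra_simps)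
  show abs_sup: "\<bar>u\<bar> = sup u (- u)" for u :: "'a \<Rightarrow>\<^sub>L 'b" by (rule abs_blinfun_def)
  show "norm f \<le> norm g" if fg: "\<bar>f\<bar> \<le> \<bar>g\<bar>"
  proof (rule norm_blinfun_bound)
    have up: "u \<le> \<bar>u\<bar>" "- u \<le> \<bar>u\<bar>" for u :: "'a \<Rightarrow>\<^sub>L 'b"
      using blinfun_pos_ge[of "u + u"] blinfun_pos_nonneg[of "u + u"]
      by (simp_all add: abs_blinfun_def sup_blinfun_def algebra_simps)
    fix x :: 'a
    have bd: "\<bar>g\<bar> \<bar>x\<bar> \<le> (norm g * norm x) *\<^sub>R 1"
    proof -
      let ?B = "(norm g * norm x) *\<^sub>R (1::'b)"
      have "rk_pos (g + g) \<bar>x\<bar> \<le> ?B + g \<bar>x\<bar>"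
      proof (rule rk_least)
        fix y assume y: "y \<in> {0..\<bar>x\<bar>}"
        have "y + y - \<bar>x\<bar> \<le> \<bar>x\<bar>" using y add_mono[of y "\<bar>x\<bar>" y "\<bar>x\<bar>"] by (simp add: algebra_simps)
        moreover have "- (y + y - \<bar>x\<bar>) \<le> \<bar>x\<bar>" using y by (simp add: algebra_simps)
        ultimately have "\<bar>y + y - \<bar>x\<bar>\<bar> \<le> \<bar>x\<bar>" by (rule abs_leI)
        then have "norm (y + y - \<bar>x\<bar>) \<le> norm x" by (rule norm_mono_abs)
        then have "norm (g (y + y - \<bar>x\<bar>)) \<le> norm g * norm x"
          by (meson mult_left_mono norm_blinfun norm_ge_zero order_trans)
        then have "g (y + y - \<bar>x\<bar>) \<le> ?B" by (rule real_scalar_le_norm)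
        then show "(g + g) y \<le> ?B + g \<bar>x\<bar>"
          by (simp add: blinfun.diff_right blinfun.add_right blinfun.add_left algebra_simps)
      qed simp
      then show ?thesis
        by (simp add: abs_blinfun_def sup_blinfun_def blinfun.add_left blinfun.diff_left blinfun.minus_left
            blinfun_pos_apply algebra_simps)
    qed
    have dom: "u z \<le> (norm g * norm x) *\<^sub>R 1" if u: "u = f \<or> u = - f" and z: "z = x" for u z
    proof -
      have ug: "u \<le> \<bar>g\<bar>" "- u \<le> \<bar>g\<bar>" using u up[of f] fg by (auto intro: order_trans)
      have xx: "x = pprt x - (- nprt x)" "\<bar>x\<bar> = pprt x + (- nprt x)"
        using prts[of x] by (simp_all add: abs_prts)
      have "u (pprt x) \<le> \<bar>g\<bar> (pprt x)" using ug(1) by (simp add: less_eq_blinfun_def)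
      moreover have "(- u) (- nprt x) \<le> \<bar>g\<bar> (- nprt x)"
        using ug(2) unfolding less_eq_blinfun_def by simp
      ultimately have "u (pprt x) + (- u) (- nprt x) \<le> \<bar>g\<bar> (pprt x) + \<bar>g\<bar> (- nprt x)"
        by (rule add_mono)
      also have "u (pprt x) + (- u) (- nprt x) = u x"
        by (subst (3) xx(1)) (simp only: blinfun.diff_right blinfun.minus_left add_uminus_conv_diff)
      also have "\<bar>g\<bar> (pprt x) + \<bar>g\<bar> (- nprt x) = \<bar>g\<bar> \<bar>x\<bar>"
        by (simp only: xx(2) blinfun.add_right)
      finally show ?thesis using bd z by (auto intro: order_trans)
    qed
    show "norm (f x) \<le> norm g * norm x"
      using dom[of f x] dom[of "- f" x] by (intro real_scalar_norm_le) (auto simp: blinfun.minus_left)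
  qed simp
qed

end

section \<open>Disjointness and order L-weakly compact operators\<close>

definition disjoint_seq :: "(nat \<Rightarrow> 'a::banach_lattice) \<Rightarrow> bool"
  where "disjoint_seq x \<longleftrightarrow> (\<forall>m n. m \<noteq> n \<longrightarrow> inf \<bar>x m\<bar> \<bar>x n\<bar> = 0)"

definition solid_hull :: "'a::banach_lattice set \<Rightarrow> 'a set"
  where "solid_hull A = {y. \<exists>a\<in>A. \<bar>y\<bar> \<le> \<bar>a\<bar>}"

definition L_weakly_compact :: "'a::banach_lattice set \<Rightarrow> bool"
  where "L_weakly_compact A \<longleftrightarrow> A \<noteq> {} \<and> bounded A \<and>
    (\<forall>x. disjoint_seq x \<and> range x \<subseteq> solid_hull A \<longrightarrow> (\<lambda>n. norm (x n)) \<longlonglongrightarrow> 0)"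

definition order_L_weakly_compact :: "('a::banach_lattice \<Rightarrow>\<^sub>L 'b::banach_lattice) \<Rightarrow> bool"
  where "order_L_weakly_compact T \<longleftrightarrow> (\<forall>x\<ge>0. L_weakly_compact (blinfun_apply T ` {0..x}))"

definition order_bounded_seq :: "(nat \<Rightarrow> 'a::banach_lattice) \<Rightarrow> bool"
  where "order_bounded_seq x \<longleftrightarrow> (\<exists>a b. range x \<subseteq> {a..b})"

definition dual_adjoint ::
  "('a::real_normed_vector \<Rightarrow>\<^sub>L 'b::real_normed_vector) \<Rightarrow> ('b \<Rightarrow>\<^sub>L real) \<Rightarrow> ('a \<Rightarrow>\<^sub>L real)"
  where "dual_adjoint T f = f o\<^sub>L T"

text \<open>For functionals, pointwise convergence on \<open>'a\<close> is weak-star convergence.\<close>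

abbreviation weak_star_topology :: "('a::real_normed_vector \<Rightarrow>\<^sub>L real) topology"
  where "weak_star_topology \<equiv> strong_operator_topology"

end

theory Submission
  imports Defs
begin

text \<open>
  For (1) \<open>\<Longrightarrow>\<close> (3), let \<open>A\<close> be L-weakly compact and suppose that \<open>\<bar>f n\<bar> \<bar>a n\<bar> \<ge> e > 0\<close> for some
  \<open>a n \<in> A\<close> and disjoint \<open>f n\<close> in the dual unit ball. The norm is order continuous on each interval
  \<open>{0..\<bar>a\<bar>}\<close> with \<open>a \<in> A\<close>, so \<open>\<bar>f n\<bar> \<bar>a\<bar>\<close> tends to \<open>0\<close> for every fixed \<open>a \<in> A\<close>. Along a subsequence,
  \<open>\<bar>f n\<bar>\<close> is therefore negligible on all earlier \<open>\<bar>a i\<bar>\<close>, and disjointifying the \<open>\<bar>a n\<bar>\<close> gives a disjoint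
  sequence in the solid hull of \<open>A\<close> on which \<open>\<bar>f n\<bar>\<close> stays away from \<open>0\<close>, a contradiction.

  For (3) \<open>\<Longrightarrow>\<close> (1), a disjoint sequence \<open>v\<close> with \<open>\<bar>v n\<bar> \<le> \<bar>T (y n)\<bar>\<close> and \<open>norm (v n) \<ge> e\<close> yields disjoint
  \<open>w n\<close> below the positive part of \<open>T (y n)\<close> or of \<open>- T (y n)\<close>. The Hahn-Banach theorem gives
  positive functionals that norm \<open>w n\<close> and vanish on everything disjoint from it; disjointifying
  these functionals in the dual gives disjoint \<open>f n\<close> with \<open>\<bar>f n (T (y n))\<bar>\<close> bounded away from \<open>0\<close>.

  The equivalence with (2) is the Riesz-Kantorovich formula for \<open>\<bar>T' f\<bar>\<close>.
\<close>

section \<open>Disjointification\<close>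

text \<open>Distributing \<open>+\<close> over \<open>inf\<close> turns the right side into the
  infimum of \<open>z + z\<close>, \<open>u + z\<close>, \<open>z + v\<close> and
  \<open>u + v\<close>, each of which dominates the left side.\<close>

lemma inf_add_le:
  fixes z u v :: "'a::banach_lattice"
  assumes "0 \<le> z" "0 \<le> u" "0 \<le> v"
  shows "inf z (u + v) \<le> inf z u + inf z v"
proof -
  have "inf z u + inf z v = inf (inf (z + z) (u + z)) (inf (z + v) (u + v))"
    by (simp add: add_inf_distrib_left add_inf_distrib_right)
  moreover have "inf z (u + v) \<le> z" by simp
  ultimately show ?thesis
    using assms by (auto intro: add_increasing add_increasing2)
qed

lemma inf_sum_le:
  fixes z :: "'a::banach_lattice"
  assumes "finite I" "0 \<le> z" "\<And>i. i \<in> I \<Longrightarrow> 0 \<le> u i"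
  shows "inf z (sum u I) \<le> (\<Sum>i\<in>I. inf z (u i))"
  using assms
proof (induction I rule: finite_induct)
  case (insert i I)
  have "inf z (u i + sum u I) \<le> inf z (u i) + inf z (sum u I)"
    using insert.prems by (intro inf_add_le sum_nonneg) auto
  also have "\<dots> \<le> inf z (u i) + (\<Sum>j\<in>I. inf z (u j))"
    using insert by (intro add_left_mono) auto
  finally show ?case using insert by simp
qed (simp add: inf_absorb2)

lemma inf_scaleR_le:
  fixes x y :: "'a::banach_lattice"
  assumes "1 \<le> c" "0 \<le> x" "0 \<le> y"
  shows "inf x (c *\<^sub>R y) \<le> c *\<^sub>R inf x y"
proof -
  have "(1/c) *\<^sub>R inf x (c *\<^sub>R y) \<le> inf x y"
  proof (rule inf_greatest)
    have "(1/c) *\<^sub>R inf x (c *\<^sub>R y) \<le> (1/c) *\<^sub>R x"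
      using assms by (intro scaleR_left_mono) auto
    also have "\<dots> \<le> 1 *\<^sub>R x" using assms by (intro scaleR_right_mono) auto
    finally show "(1/c) *\<^sub>R inf x (c *\<^sub>R y) \<le> x" by simp
    have "(1/c) *\<^sub>R inf x (c *\<^sub>R y) \<le> (1/c) *\<^sub>R (c *\<^sub>R y)"
      using assms by (intro scaleR_left_mono) auto
    then show "(1/c) *\<^sub>R inf x (c *\<^sub>R y) \<le> y" using assms by simp
  qed
  then have "c *\<^sub>R ((1/c) *\<^sub>R inf x (c *\<^sub>R y)) \<le> c *\<^sub>R inf x y"
    using assms by (intro scaleR_left_mono) auto
  then show ?thesis using assms by simp
qed

lemma inf_plus_pprt_diff: "inf x u + pprt (x - u) = (x::'a::banach_lattice)"
proof -
  have "inf x u + pprt (x - u) = inf u x + (sup x u - u)"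
    by (simp add: pprt_def inf_commute add_sup_distrib_right flip: add_uminus_conv_diff)
  also have "\<dots> = x" using add_eq_inf_sup[of x u] by (simp add: inf_commute algebra_simps)
  finally show ?thesis .
qed

lemma inf_pprt_neg: "inf (pprt u) (pprt (- u)) = (0::'a::banach_lattice)"
proof -
  have "pprt u = u + pprt (- u)" using prts[of u] by (metis pprt_neg diff_conv_add_uminus eq_diff_eq)
  then have "inf (pprt u) (pprt (- u)) = inf u 0 + pprt (- u)"
    by (metis add_0 add_inf_distrib_right)
  also have "\<dots> = nprt u + - nprt u" by (simp only: pprt_neg nprt_def)
  finally show ?thesis by simp
qed

lemma pprt_ge: "x \<le> pprt (x::'a::banach_lattice)"
  by (simp add: pprt_def)

lemma pprt_le: "x \<le> y \<Longrightarrow> 0 \<le> y \<Longrightarrow> pprt (x::'a::banach_lattice) \<le> y"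
  by (simp add: pprt_def)

lemma inf_eq_0_mono:
  fixes v w :: "'a::banach_lattice"
  assumes "inf x y = 0" "0 \<le> v" "v \<le> x" "0 \<le> w" "w \<le> y"
  shows "inf v w = 0"
  by (metis assms inf_mono inf_greatest order.antisym)

text \<open>Both arguments come from \<open>t = x - c *\<^sub>R y\<close>: the second is the
  positive part of a positive multiple of \<open>- t\<close>, hence disjoint from
  \<open>pprt t\<close>.\<close>

lemma inf_pprt_diff_scaleR:
  fixes x y :: "'a::banach_lattice"
  assumes "0 < c"
  shows "inf (pprt (x - c *\<^sub>R y)) (pprt (y - (1/c) *\<^sub>R x)) = 0"
proof -
  define t where "t = x - c *\<^sub>R y"
  \<comment> \<open>\<open>inf_scaleR_le\<close> asks for a factor of at least 1, so
    \<open>1/c\<close> is enlarged to \<open>d\<close>.\<close>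
  define d where "d = max 1 (1/c)"
  have yt: "y - (1/c) *\<^sub>R x = (1/c) *\<^sub>R (- t)"
    using assms by (simp add: t_def scaleR_right_diff_distrib)
  have "(1/c) *\<^sub>R (- t) \<le> (1/c) *\<^sub>R pprt (- t)"
    using assms by (intro scaleR_left_mono pprt_ge) auto
  also have "\<dots> \<le> d *\<^sub>R pprt (- t)"
    by (intro scaleR_right_mono) (auto simp: d_def)
  finally have le: "pprt (y - (1/c) *\<^sub>R x) \<le> d *\<^sub>R pprt (- t)"
    unfolding yt by (rule pprt_le) (auto intro!: scaleR_nonneg_nonneg simp: d_def)
  have "inf (pprt t) (d *\<^sub>R pprt (- t)) \<le> d *\<^sub>R inf (pprt t) (pprt (- t))"
    by (rule inf_scaleR_le) (auto simp: d_def)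
  then have "inf (pprt t) (d *\<^sub>R pprt (- t)) = 0"
    by (intro order.antisym) (auto simp: inf_pprt_neg d_def intro!: scaleR_nonneg_nonneg)
  from inf_eq_0_mono[OF this _ _ _ le] show ?thesis by (simp add: t_def)
qed

text \<open>The classical disjointification: the first subtrahend makes a term disjoint from the earlier
  ones, the second one from the later ones.\<close>

definition disjointify :: "(nat \<Rightarrow> 'a::banach_lattice) \<Rightarrow> 'a \<Rightarrow> nat \<Rightarrow> 'a"
  where "disjointify x y k = pprt (x k - 4^k *\<^sub>R (\<Sum>i<k. x i) - (1/2)^k *\<^sub>R y)"

lemma disjointify_nonneg: "0 \<le> disjointify x y k"
  by (simp add: disjointify_def)

lemma disjointify_le:
  assumes "\<And>k. 0 \<le> x k" "0 \<le> y"
  shows "disjointify x y k \<le> x k"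
proof -
  have "0 \<le> 4^k *\<^sub>R (\<Sum>i<k. x i) + (1/2)^k *\<^sub>R y"
    using assms by (intro add_nonneg_nonneg scaleR_nonneg_nonneg sum_nonneg) auto
  then show ?thesis using assms by (auto simp: disjointify_def algebra_simps intro!: pprt_le)
qed

text \<open>Cutting \<open>x k\<close> at \<open>u\<close> leaves \<open>pprt (x k - u)\<close>;
  subtracting the further multiple of \<open>y\<close> under the positive part costs at most that
  multiple.\<close>

lemma le_disjointify:
  assumes "\<And>k. 0 \<le> x k" "0 \<le> y"
  shows "x k \<le> inf (x k) (4^k *\<^sub>R (\<Sum>i<k. x i)) + disjointify x y k + (1/2)^k *\<^sub>R y"
proof -
  define u where "u = 4^k *\<^sub>R (\<Sum>i<k. x i)"
  have "0 \<le> (1/2)^k *\<^sub>R y" using assms by (intro scaleR_nonneg_nonneg) auto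
  moreover have "x k - u - (1/2)^k *\<^sub>R y \<le> disjointify x y k"
    unfolding disjointify_def u_def by (rule pprt_ge)
  ultimately have "pprt (x k - u) \<le> disjointify x y k + (1/2)^k *\<^sub>R y"
    by (intro pprt_le add_nonneg_nonneg disjointify_nonneg) (auto simp: algebra_simps)
  then show ?thesis using inf_plus_pprt_diff[of "x k" u]
    by (metis add.assoc add_left_mono u_def)
qed

lemma disjoint_seq_disjointify:
  assumes x: "\<And>k. 0 \<le> x k" and y: "\<And>k. (1/2)^k *\<^sub>R x k \<le> y"
  shows "disjoint_seq (disjointify x y)"
proof -
  have y0: "0 \<le> y" using x[of 0] y[of 0] by simp
  have less: "inf (disjointify x y k) (disjointify x y i) = 0" if "i < k" for i k
  proof (rule inf_eq_0_mono[OF inf_pprt_diff_scaleR[of "4^k" "x k" "x i"]])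
    have "x i \<le> (\<Sum>i<k. x i)" using sum_mono2[of "{..<k}" "{i}" x] that x by simp
    then have "4^k *\<^sub>R x i \<le> 4^k *\<^sub>R (\<Sum>i<k. x i) + (1/2)^k *\<^sub>R y"
      using y0 by (intro add_increasing2 scaleR_left_mono scaleR_nonneg_nonneg) auto
    then show "disjointify x y k \<le> pprt (x k - 4^k *\<^sub>R x i)"
      by (auto simp: disjointify_def algebra_simps intro!: pprt_mono)
    \<comment> \<open>\<open>1 / 4^k\<close> is the square of \<open>(1/2)^k\<close>: one factor
      grows to \<open>(1/2)^i\<close> because \<open>i < k\<close>, the other brings
      \<open>x k\<close> below \<open>y\<close>.\<close>
    have "(1/2::real)^k * (1/2)^k \<le> (1/2)^i * (1/2)^k"
      using that by (intro mult_right_mono power_decreasing) auto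
    then have "(1 / 4^k) *\<^sub>R x k \<le> ((1/2)^i * (1/2)^k) *\<^sub>R x k"
      using x by (intro scaleR_right_mono) (auto simp: power_divide simp flip: power_mult_distrib)
    also have "\<dots> = (1/2)^i *\<^sub>R ((1/2)^k *\<^sub>R x k)" by simp
    also have "\<dots> \<le> (1/2)^i *\<^sub>R y" using y by (intro scaleR_left_mono) auto
    also have "\<dots> \<le> 4^i *\<^sub>R (\<Sum>i<i. x i) + (1/2)^i *\<^sub>R y"
      using x by (intro add_increasing scaleR_nonneg_nonneg sum_nonneg) auto
    finally show "disjointify x y i \<le> pprt (x i - (1 / 4^k) *\<^sub>R x k)"
      by (auto simp: disjointify_def algebra_simps intro!: pprt_mono)
  qed (auto simp: disjointify_nonneg)
  show ?thesis unfolding disjoint_seq_def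
    using less by (metis abs_of_nonneg disjointify_nonneg inf_commute linorder_neqE_nat)
qed

section \<open>Extraction of subsequences\<close>

lemma diagonal_subseq:
  fixes b :: "nat \<Rightarrow> nat \<Rightarrow> real" and \<delta> :: "nat \<Rightarrow> real"
  assumes lim: "\<And>i. b i \<longlonglongrightarrow> 0" and \<delta>: "\<And>k. 0 < \<delta> k"
  obtains r where "strict_mono r" "\<And>i k. i < k \<Longrightarrow> b (r i) (r k) < \<delta> k"
proof -
  \<comment> \<open>Controlling all \<open>b m\<close> with \<open>m \<le> r k\<close>, not only
    those at chosen indices, makes the condition on the next index depend on \<open>r k\<close>
    alone, as dependent choice requires.\<close>
  have "\<exists>r. \<forall>k. True \<and> (r k < r (Suc k) \<and> (\<forall>m\<le>r k. b m (r (Suc k)) < \<delta> (Suc k)))"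
  proof (rule dependent_nat_choice)
    fix x k
    have "eventually (\<lambda>n. \<forall>m\<in>{..x}. b m n < \<delta> (Suc k)) sequentially"
      using lim \<delta> by (intro eventually_ball_finite) (auto intro: order_tendstoD(2))
    then obtain n where "n > x" "\<forall>m\<in>{..x}. b m n < \<delta> (Suc k)"
      using eventually_happens'[OF sequentially_bot eventually_conj[OF _ eventually_gt_at_top[of x]]]
      by blast
    then show "\<exists>y. True \<and> x < y \<and> (\<forall>m\<le>x. b m y < \<delta> (Suc k))" by auto
  qed simp
  then obtain r where r: "\<And>k. r k < r (Suc k)" "\<And>k m. m \<le> r k \<Longrightarrow> b m (r (Suc k)) < \<delta> (Suc k)"
    by blast
  have mono: "strict_mono r" using r(1) by (simp add: strict_mono_Suc_iff)
  have "b (r i) (r k) < \<delta> k" if "i < k" for i k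
  proof -
    obtain l where l: "k = Suc l" using \<open>i < k\<close> by (cases k) auto
    have "r i \<le> r l" using \<open>i < k\<close> l mono by (simp add: strict_mono_less_eq)
    then show ?thesis using r(2) l by simp
  qed
  with mono show thesis by (rule that)
qed

lemma not_null_subseq:
  fixes u :: "nat \<Rightarrow> real"
  assumes "\<And>n. 0 \<le> u n" "\<not> u \<longlonglongrightarrow> 0"
  obtains e r where "0 < e" "strict_mono (r :: nat \<Rightarrow> nat)" "\<And>n. e \<le> u (r n)"
proof -
  obtain e where e: "0 < e" "\<not> eventually (\<lambda>n. dist (u n) 0 < e) sequentially"
    using assms(2) unfolding tendsto_iff by blast
  then have "\<exists>\<^sub>F n in sequentially. e \<le> u n"
    unfolding not_eventually using assms(1) by (simp add: not_less)
  then have inf: "infinite {n. e \<le> u n}" by (simp add: INFM_iff_infinite flip: cofinite_eq_sequentially)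
  show thesis
  proof (rule that[OF e(1) strict_mono_enumerate[OF inf]])
    show "e \<le> u (enumerate {n. e \<le> u n} n)" for n using enumerate_in_set[OF inf, of n] by simp
  qed
qed

lemma disjoint_seq_subseq: "disjoint_seq x \<Longrightarrow> strict_mono r \<Longrightarrow> disjoint_seq (\<lambda>n. x (r n))"
  unfolding disjoint_seq_def by (metis strict_mono_eq)

lemma L_weakly_compact_mono:
  assumes "L_weakly_compact A" "B \<subseteq> solid_hull A" "B \<noteq> {}"
  shows "L_weakly_compact B"
proof -
  have sub: "solid_hull B \<subseteq> solid_hull A"
    using assms(2) unfolding solid_hull_def by (blast intro: order_trans)
  obtain C where C: "\<And>a. a \<in> A \<Longrightarrow> norm a \<le> C"
    using assms(1) unfolding L_weakly_compact_def bounded_iff by blast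
  have "norm b \<le> C" if "b \<in> B" for b
    using assms(2) that C norm_mono_abs unfolding solid_hull_def by (blast intro: order_trans)
  then have "bounded B" unfolding bounded_iff by blast
  with sub assms show ?thesis unfolding L_weakly_compact_def by blast
qed

lemma L_weakly_compact_interval:
  assumes "L_weakly_compact A" "a \<in> A"
  shows "L_weakly_compact {0..\<bar>a\<bar>}"
  using assms by (intro L_weakly_compact_mono[OF assms(1)]) (auto simp: solid_hull_def abs_of_nonneg)

lemma L_weakly_compact_interval_null:
  assumes "L_weakly_compact {0..a}" "disjoint_seq x" "\<And>n. x n \<in> {0..a}"
  shows "(\<lambda>n. norm (x n)) \<longlonglongrightarrow> 0"
proof -
  have "range x \<subseteq> solid_hull {0..a}" using assms(3) unfolding solid_hull_def by blast
  then show ?thesis using assms(1,2) unfolding L_weakly_compact_def by blast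
qed

section \<open>Order continuity of the norm on intervals\<close>

text \<open>The last hypothesis says that any \<open>k + 1\<close> of the \<open>x n\<close> have infimum \<open>0\<close>.\<close>

lemma bounded_multiplicity_null:
  fixes x :: "nat \<Rightarrow> 'a::banach_lattice"
  assumes L: "L_weakly_compact {0..a}"
    and "\<And>n. x n \<in> {0..a}"
    and "\<And>M z. finite M \<Longrightarrow> card M = Suc k \<Longrightarrow> (\<And>n. n \<in> M \<Longrightarrow> z \<le> x n) \<Longrightarrow> z \<le> 0"
  shows "(\<lambda>n. norm (x n)) \<longlonglongrightarrow> 0"
  using assms(2,3)
proof (induction k arbitrary: x)
  case 0
  have "x n \<le> 0" for n using 0(2)[of "{n}" "x n"] by simp
  then have "x n = 0" for n using 0(1)[of n] by (simp add: order.antisym)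
  then show ?case by simp
next
  case (Suc k)
  show ?case
  proof (rule ccontr)
    assume "\<not> ?thesis"
    then obtain e r where e: "0 < e" and r: "strict_mono (r :: nat \<Rightarrow> nat)"
        and ge: "\<And>n. e \<le> norm (x (r n))"
      by (rule not_null_subseq[OF norm_ge_zero]) blast
    \<comment> \<open>Infima with a fixed term lower the multiplicity: a common lower bound of
      \<open>k + 1\<close> of them is one of \<open>k + 2\<close> terms of \<open>x\<close>. The
      shift by \<open>Suc i\<close> keeps \<open>r i\<close> apart from the other indices.\<close>
    have "(\<lambda>n. norm (inf (x (r n)) (x (r i)))) \<longlonglongrightarrow> 0" for i
    proof (rule LIMSEQ_offset[where k="Suc i"], rule Suc.IH)
      show "inf (x (r (n + Suc i))) (x (r i)) \<in> {0..a}" for n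
        using Suc.prems(1) by (auto intro: le_infI2)
      fix M z
      assume M: "finite M" "card M = Suc k"
        and z: "\<And>n. n \<in> M \<Longrightarrow> z \<le> inf (x (r (n + Suc i))) (x (r i))"
      let ?N = "(\<lambda>n. r (n + Suc i)) ` M"
      have "inj_on (\<lambda>n. r (n + Suc i)) M" using r by (auto simp: inj_on_def strict_mono_eq)
      then have "card ?N = Suc k" using M by (simp add: card_image)
      moreover have "r i \<notin> ?N" using r by (auto simp: strict_mono_eq)
      ultimately have card: "card (insert (r i) ?N) = Suc (Suc k)" using M by simp
      obtain m where "m \<in> M" using M by fastforce
      then show "z \<le> 0" using M z by (intro Suc.prems(2)[OF _ card]) auto
    qed
    \<comment> \<open>The tolerance is tuned to \<open>disjointify\<close>: a sum of
      \<open>n\<close> such terms times \<open>4^n\<close> is at most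
      \<open>(1/2)^n\<close>.\<close>
    then obtain s where s: "strict_mono s" and
      small: "\<And>i j. i < j \<Longrightarrow> norm (inf (x (r (s j))) (x (r (s i)))) < (1/8)^j / Suc j"
      by (rule diagonal_subseq[where b="\<lambda>i n. norm (inf (x (r n)) (x (r i)))"
            and \<delta>="\<lambda>j. (1/8)^j / Suc j"]) auto
    define w where "w = (\<lambda>n. x (r (s n)))"
    have w: "0 \<le> w n" "w n \<le> a" for n using Suc.prems(1) by (auto simp: w_def)
    have a: "0 \<le> a" using w[of 0] by simp
    have wa: "(1/2)^n *\<^sub>R w n \<le> a" for n
    proof -
      have "(1/2)^n *\<^sub>R w n \<le> 1 *\<^sub>R w n" using w by (intro scaleR_right_mono power_le_one) auto
      then show ?thesis using w[of n] by simp
    qed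
    define D where "D = disjointify w a"
    have "D n \<in> {0..a}" for n
      using disjointify_le[of w a n] w a by (auto simp: D_def disjointify_nonneg intro: order_trans)
    moreover have "disjoint_seq D" unfolding D_def using w wa by (intro disjoint_seq_disjointify)
    ultimately have D0: "(\<lambda>n. norm (D n)) \<longlonglongrightarrow> 0" using L by (intro L_weakly_compact_interval_null)
    have "norm (w n) \<le> (1/2)^n + norm (D n) + (1/2)^n * norm a" for n
    proof -
      define u where "u = inf (w n) (4^n *\<^sub>R (\<Sum>i<n. w i))"
      have sw: "0 \<le> (\<Sum>i<n. w i)" using w by (intro sum_nonneg) auto
      have u0: "0 \<le> u" using w sw by (auto simp: u_def intro!: scaleR_nonneg_nonneg)
      have "u \<le> 4^n *\<^sub>R inf (w n) (\<Sum>i<n. w i)"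
        unfolding u_def using w sw by (intro inf_scaleR_le) auto
      also have "\<dots> \<le> 4^n *\<^sub>R (\<Sum>i<n. inf (w n) (w i))"
        using w by (intro scaleR_left_mono inf_sum_le) auto
      finally have "norm u \<le> norm (4^n *\<^sub>R (\<Sum>i<n. inf (w n) (w i)))"
        using u0 by (intro norm_mono_nonneg)
      also have "\<dots> \<le> 4^n * (\<Sum>i<n. norm (inf (w n) (w i)))"
        by (simp add: norm_sum)
      also have "\<dots> \<le> 4^n * (\<Sum>i<n. (1/8)^n / Suc n)"
        using small by (intro mult_left_mono sum_mono) (auto simp: w_def less_imp_le)
      also have "\<dots> = (1/2)^n * (n / Suc n)"
        by (simp flip: power_mult_distrib)
      also have "\<dots> \<le> (1/2)^n * 1" by (intro mult_left_mono) auto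
      finally have nu: "norm u \<le> (1/2)^n" by simp
      have "norm (w n) \<le> norm (u + D n + (1/2)^n *\<^sub>R a)"
        using le_disjointify[of w a n] w a by (intro norm_mono_nonneg) (auto simp: u_def D_def)
      also have "\<dots> \<le> norm u + norm (D n) + norm ((1/2)^n *\<^sub>R a)"
        by (intro order_trans[OF norm_triangle_ineq] add_right_mono norm_triangle_ineq)
      finally show ?thesis using nu by simp
    qed
    then have "e \<le> (1/2)^n + norm (D n) + (1/2)^n * norm a" for n
      using ge[of "s n"] by (metis order_trans w_def)
    moreover have "(\<lambda>n. (1/2)^n + norm (D n) + (1/2)^n * norm a) \<longlonglongrightarrow> 0 + 0 + 0 * norm a"
      by (intro tendsto_intros D0 LIMSEQ_power_zero) auto
    ultimately have "e \<le> 0" by (intro LIMSEQ_le_const) auto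
    with e show False by simp
  qed
qed

text \<open>\<open>pprt z\<close> lies below the sum of the \<open>pprt (w n)\<close>, hence below
  the sum of the \<open>pprt (- w n)\<close>. Being below each \<open>pprt (w n)\<close>, it is
  disjoint from each \<open>pprt (- w n)\<close>, thus from their sum, and so it vanishes.\<close>

lemma le_pprt_sum_nonpos:
  fixes w :: "'i \<Rightarrow> 'a::banach_lattice"
  assumes fin: "finite M" and ne: "M \<noteq> {}" and sum: "sum w M \<le> 0"
    and z: "\<And>n. n \<in> M \<Longrightarrow> z \<le> pprt (w n)"
  shows "z \<le> 0"
proof -
  let ?z = "pprt z"
  obtain m where m: "m \<in> M" using ne by blast
  have zn: "inf ?z (pprt (- w n)) = 0" if "n \<in> M" for n
    using inf_eq_0_mono[OF inf_pprt_neg[of "w n"], of ?z "pprt (- w n)"] z[OF that]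
    by (simp add: pprt_le)
  have "w n = pprt (w n) - pprt (- w n)" for n
    by (metis prts pprt_neg diff_minus_eq_add)
  then have "sum w M = (\<Sum>n\<in>M. pprt (w n) - pprt (- w n))" by (intro sum.cong) auto
  also have "\<dots> = (\<Sum>n\<in>M. pprt (w n)) - (\<Sum>n\<in>M. pprt (- w n))" by (rule sum_subtractf)
  finally have le: "(\<Sum>n\<in>M. pprt (w n)) \<le> (\<Sum>n\<in>M. pprt (- w n))" using sum by simp
  have "?z \<le> pprt (w m)" using z[OF m] by (simp add: pprt_le)
  also have "\<dots> \<le> (\<Sum>n\<in>M. pprt (w n))"
    using sum_mono2[of M "{m}" "\<lambda>n. pprt (w n)"] fin m by simp
  also note le
  finally have "?z = inf ?z (\<Sum>n\<in>M. pprt (- w n))" by (simp add: inf_absorb1)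
  also have "\<dots> \<le> (\<Sum>n\<in>M. inf ?z (pprt (- w n)))" using fin by (intro inf_sum_le) auto
  also have "\<dots> = 0" using zn by simp
  finally show ?thesis using pprt_ge order_trans by blast
qed

text \<open>At most \<open>m\<close> of the \<open>d n\<close> can exceed \<open>a / Suc m\<close> at the same place, so that the truncations
  \<open>pprt (d n - a / Suc m)\<close> have bounded multiplicity.\<close>

lemma bounded_sums_null:
  fixes d :: "nat \<Rightarrow> 'a::banach_lattice"
  assumes L: "L_weakly_compact {0..a}" and d: "\<And>n. 0 \<le> d n" and sums: "\<And>N. (\<Sum>n<N. d n) \<le> a"
  shows "(\<lambda>n. norm (d n)) \<longlonglongrightarrow> 0"
proof -
  have sumM: "sum d M \<le> a" if "finite M" for M
  proof -
    obtain N where "M \<subseteq> {..<N}" using finite_nat_iff_bounded \<open>finite M\<close> by blast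
    then have "sum d M \<le> sum d {..<N}" using d by (intro sum_mono2) auto
    then show ?thesis using sums order_trans by blast
  qed
  have a: "0 \<le> a" using sums[of 0] by simp
  have da: "d n \<le> a" for n using sumM[of "{n}"] by simp
  have lim: "(\<lambda>n. norm (pprt (d n - (1 / Suc m) *\<^sub>R a))) \<longlonglongrightarrow> 0" for m
  proof (rule bounded_multiplicity_null[OF L, where k=m])
    have "0 \<le> (1 / Suc m) *\<^sub>R a" using a by (intro scaleR_nonneg_nonneg) auto
    then have "d n - (1 / Suc m) *\<^sub>R a \<le> a" for n
      using order_trans[OF _ da[of n], of "d n - (1 / Suc m) *\<^sub>R a"] by simp
    then show "pprt (d n - (1 / Suc m) *\<^sub>R a) \<in> {0..a}" for n
      using a by (auto intro!: pprt_le simp del: of_nat_Suc)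
    fix M z
    assume M: "finite M" "card M = Suc m"
      and z: "\<And>n. n \<in> M \<Longrightarrow> z \<le> pprt (d n - (1 / Suc m) *\<^sub>R a)"
    show "z \<le> 0"
    proof (rule le_pprt_sum_nonpos[OF M(1) _ _ z])
      have "(\<Sum>n\<in>M. (1 / Suc m) *\<^sub>R a) = (card M * (1 / Suc m)) *\<^sub>R a"
        by (simp add: sum_constant_scaleR)
      also have "\<dots> = a" using M by simp
      finally show "(\<Sum>n\<in>M. d n - (1 / Suc m) *\<^sub>R a) \<le> 0"
        using sumM[OF M(1)] by (simp add: sum_subtractf)
    qed (use M in auto)
  qed
  show ?thesis
  proof (rule tendstoI)
    fix e :: real assume e: "0 < e"
    obtain m where m: "norm a / Suc m < e / 2"
    proof -
      obtain m :: nat where "norm a / (e / 2) < m" using reals_Archimedean2 by blast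
      then have "norm a < m * (e / 2)" using e by (simp add: field_simps)
      also have "\<dots> \<le> Suc m * (e / 2)" using e by (intro mult_right_mono) auto
      finally show thesis using that by (simp add: field_simps)
    qed
    have "eventually (\<lambda>n. norm (pprt (d n - (1 / Suc m) *\<^sub>R a)) < e / 2) sequentially"
      using lim[of m] e by (intro order_tendstoD(2)) auto
    then show "eventually (\<lambda>n. dist (norm (d n)) 0 < e) sequentially"
    proof eventually_elim
      case (elim n)
      have "d n \<le> pprt (d n - (1 / Suc m) *\<^sub>R a) + (1 / Suc m) *\<^sub>R a"
        using pprt_ge[of "d n - (1 / Suc m) *\<^sub>R a"] by (simp only: diff_le_eq)
      then have "norm (d n) \<le> norm (pprt (d n - (1 / Suc m) *\<^sub>R a) + (1 / Suc m) *\<^sub>R a)"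
        using d by (intro norm_mono_nonneg)
      also have "\<dots> \<le> norm (pprt (d n - (1 / Suc m) *\<^sub>R a)) + norm a / Suc m"
        by (rule order_trans[OF norm_triangle_ineq]) simp
      finally have "norm (d n) < e" using elim m by linarith
      then show ?case by simp
    qed
  qed
qed

text \<open>Order continuity of the norm: increments that stay large along a subsequence would be
  nonnegative with telescoping sums below \<open>a\<close>, against
  \<open>bounded_sums_null\<close>.\<close>

lemma incseq_Cauchy:
  fixes s :: "nat \<Rightarrow> 'a::banach_lattice"
  assumes L: "L_weakly_compact {0..a}" and s: "\<And>n. s n \<in> {0..a}" and inc: "incseq s"
  shows "Cauchy s"
proof (rule ccontr)
  assume "\<not> Cauchy s"
  then obtain e where e: "0 < e" and far: "\<And>M. \<exists>m\<ge>M. \<exists>n\<ge>M. e \<le> dist (s m) (s n)"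
    unfolding Cauchy_def by (auto simp: not_less)
  \<comment> \<open>Two distant terms from \<open>M\<close> on yield a term distant from
    \<open>s M\<close> itself, because an increment only grows when its lower index moves down to
    \<open>M\<close>.\<close>
  have far': "\<exists>n>M. e \<le> norm (s n - s M)" for M
  proof -
    have *: "\<exists>n>M. e \<le> norm (s n - s M)" if "M \<le> m" "m \<le> n" "e \<le> norm (s n - s m)" for m n
    proof -
      have "norm (s n - s m) \<le> norm (s n - s M)"
        using inc that by (intro norm_mono_nonneg) (auto simp: incseq_def)
      then have "e \<le> norm (s n - s M)" using that by simp
      moreover have "M < n" using that calculation e by (cases "M = n") auto
      ultimately show ?thesis by blast
    qed
    obtain m n where "M \<le> m" "M \<le> n" "e \<le> dist (s m) (s n)" using far[of M] by blast
    then show ?thesis using *[of m n] *[of n m] by (metis dist_commute dist_norm linear)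
  qed
  have "\<exists>r. \<forall>k. True \<and> (r k < r (Suc k) \<and> e \<le> norm (s (r (Suc k)) - s (r k)))"
    by (rule dependent_nat_choice) (use far' in auto)
  then obtain r where r: "\<And>k. r k < r (Suc k)" "\<And>k. e \<le> norm (s (r (Suc k)) - s (r k))"
    by blast
  have "(\<lambda>k. norm (s (r (Suc k)) - s (r k))) \<longlonglongrightarrow> 0"
  proof (rule bounded_sums_null[OF L])
    show "0 \<le> s (r (Suc k)) - s (r k)" for k
      using inc r(1)[of k] by (simp add: incseq_def less_imp_le)
    show "(\<Sum>k<N. s (r (Suc k)) - s (r k)) \<le> a" for N
    proof -
      have "s (r N) \<le> a + s (r 0)" using s by (auto intro: add_increasing2)
      then show ?thesis by (simp add: sum_lessThan_telescope[of "\<lambda>k. s (r k)"] algebra_simps)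
    qed
  qed
  then have "e \<le> 0" by (rule LIMSEQ_le_const) (use r(2) in blast)
  with e show False by simp
qed

section \<open>Norm limits and order bounds\<close>

lemma norm_pprt_diff: "norm (pprt x - pprt y) \<le> norm (x - y)" for x y :: "'a::banach_lattice"
proof (rule norm_mono_abs)
  have *: "pprt u - pprt v \<le> \<bar>u - v\<bar>" for u v :: 'a
  proof -
    have "u = v + (u - v)" by simp
    also have "\<dots> \<le> pprt v + \<bar>u - v\<bar>" by (intro add_mono pprt_ge abs_ge_self)
    finally have "pprt u \<le> pprt v + \<bar>u - v\<bar>" by (intro pprt_le) auto
    then show ?thesis by (simp add: algebra_simps)
  qed
  show "\<bar>pprt x - pprt y\<bar> \<le> \<bar>x - y\<bar>"
    using *[of x y] *[of y x] by (intro abs_leI) (auto simp: abs_minus_commute)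
qed

text \<open>\<open>pprt (s n - b)\<close> is eventually \<open>0\<close> and the positive part is
  nonexpansive, so \<open>norm (pprt (l - b))\<close> is at most \<open>norm (l - s n)\<close>,
  which tends to \<open>0\<close>.\<close>

lemma tendsto_upperbound_lattice:
  fixes s :: "nat \<Rightarrow> 'a::banach_lattice"
  assumes lim: "s \<longlonglongrightarrow> l" and le: "\<And>n. N \<le> n \<Longrightarrow> s n \<le> b"
  shows "l \<le> b"
proof -
  have "norm (pprt (l - b)) \<le> norm (l - s n)" if "N \<le> n" for n
  proof -
    have "pprt (s n - b) = 0" using le[OF that] by simp
    then show ?thesis using norm_pprt_diff[of "l - b" "s n - b"] by simp
  qed
  moreover have "(\<lambda>n. norm (l - s n)) \<longlonglongrightarrow> norm (l - l)"
    using lim by (intro tendsto_intros)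
  ultimately have "norm (pprt (l - b)) \<le> 0"
    by (intro LIMSEQ_le_const[of "\<lambda>n. norm (l - s n)"]) auto
  then show ?thesis using pprt_ge[of "l - b"] by simp
qed

lemma tendsto_lowerbound_lattice:
  fixes s :: "nat \<Rightarrow> 'a::banach_lattice"
  assumes lim: "s \<longlonglongrightarrow> l" and le: "\<And>n. N \<le> n \<Longrightarrow> b \<le> s n"
  shows "b \<le> l"
  using tendsto_upperbound_lattice[of "\<lambda>n. - s n" "- l" N "- b"] tendsto_minus[OF lim] le by simp

section \<open>Disjoint functionals on L-weakly compact sets\<close>

text \<open>Geometric weights make the series converge, and its sum dominates every term. This
  supplies the element \<open>y\<close> that \<open>disjointify\<close> needs, for vectors and for
  functionals alike.\<close>

lemma weighted_upper_bound:
  fixes x :: "nat \<Rightarrow> 'a::banach_lattice"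
  assumes x: "\<And>k. 0 \<le> x k" and C: "\<And>k. norm (x k) \<le> C"
  obtains y where "\<And>k. (1/2)^k *\<^sub>R x k \<le> y"
proof -
  define z where "z = (\<lambda>k. (1/2)^k *\<^sub>R x k)"
  have z0: "0 \<le> z k" for k using x by (auto simp: z_def intro: scaleR_nonneg_nonneg)
  have "summable z"
  proof (rule summable_comparison_test)
    show "summable (\<lambda>k. (1/2)^k * C)" by (intro summable_mult2 summable_geometric) auto
    show "\<exists>N. \<forall>n\<ge>N. norm (z n) \<le> (1/2)^n * C" using C by (auto simp: z_def intro: mult_left_mono)
  qed
  then have lim: "(\<lambda>N. sum z {..<N}) \<longlonglongrightarrow> suminf z" by (rule summable_LIMSEQ)
  have "z k \<le> suminf z" for k
  proof (rule tendsto_lowerbound_lattice[OF lim])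
    show "z k \<le> sum z {..<N}" if "Suc k \<le> N" for N
      using sum_mono2[of "{..<N}" "{k}" z] z0 that by auto
  qed
  then show thesis using that unfolding z_def by blast
qed

lemma nonneg_blinfun_mono:
  fixes f :: "'a::banach_lattice \<Rightarrow>\<^sub>L real"
  assumes "0 \<le> f" "x \<le> y"
  shows "f x \<le> f y"
proof -
  have "0 \<le> f (y - x)" using assms by (simp add: less_eq_blinfun_def)
  then show ?thesis by (simp add: blinfun.diff_right)
qed

lemma abs_blinfun_le:
  fixes f :: "'a::banach_lattice \<Rightarrow>\<^sub>L real"
  shows "\<bar>f x\<bar> \<le> \<bar>f\<bar> \<bar>x\<bar>"
proof -
  have *: "g x \<le> \<bar>f\<bar> \<bar>x\<bar>" if "g \<le> \<bar>f\<bar>" "- g \<le> \<bar>f\<bar>" for g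
  proof -
    have "g (pprt x) \<le> \<bar>f\<bar> (pprt x)" "(- g) (- nprt x) \<le> \<bar>f\<bar> (- nprt x)"
      using that unfolding less_eq_blinfun_def by simp_all
    moreover have "g x = g (pprt x) + (- g) (- nprt x)"
      by (subst prts[of x]) (simp add: blinfun.add_right blinfun.minus_right blinfun.minus_left)
    moreover have "\<bar>f\<bar> \<bar>x\<bar> = \<bar>f\<bar> (pprt x) + \<bar>f\<bar> (- nprt x)"
      by (simp add: abs_prts blinfun.diff_right blinfun.minus_right)
    ultimately show ?thesis by linarith
  qed
  show ?thesis
    using *[of f] *[of "- f"] by (simp add: blinfun.minus_left abs_ge_self abs_ge_minus_self abs_le_iff)
qed

lemma blinfun_le_norm:
  fixes f :: "'a::real_normed_vector \<Rightarrow>\<^sub>L real"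
  assumes "norm f \<le> 1"
  shows "f x \<le> norm x"
proof -
  have "f x \<le> norm f * norm x" using norm_blinfun[of f x] by simp
  also have "\<dots> \<le> norm x" using assms by (intro mult_left_le_one_le) auto
  finally show ?thesis .
qed

text \<open>Disjointness means \<open>f = blinfun_pos (f - g)\<close>, so by the Riesz-Kantorovich
  formula \<open>f a\<close> is the supremum of \<open>f v - g v\<close> over \<open>v\<close> in
  \<open>{0..a}\<close>; a nearly optimal \<open>v\<close> works.\<close>

lemma disjoint_functionals_split:
  fixes f g :: "'a::banach_lattice \<Rightarrow>\<^sub>L real"
  assumes "inf f g = 0" "0 \<le> a" "0 < \<eta>"
  obtains v where "v \<in> {0..a}" "f (a - v) + g v < \<eta>"
proof -
  have "f = blinfun_pos (f - g)" using assms(1) by (simp add: inf_blinfun_def)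
  then have fa: "f a = rk_pos (f - g) a" using blinfun_pos_apply[OF assms(2)] by metis
  have "\<exists>v\<in>{0..a}. f (a - v) + g v < \<eta>"
  proof (rule ccontr)
    assume no: "\<not> ?thesis"
    have "rk_pos (f - g) a \<le> f a - \<eta>"
    proof (rule rk_least[OF assms(2)])
      fix v assume "v \<in> {0..a}"
      then have "\<eta> \<le> f (a - v) + g v" using no by (meson not_le)
      then show "(f - g) v \<le> f a - \<eta>" by (simp add: blinfun.diff_left blinfun.diff_right)
    qed
    with fa assms(3) show False by simp
  qed
  then show thesis using that by blast
qed

text \<open>If \<open>f n a\<close> stays above \<open>e\<close>, choose \<open>v n\<close> in \<open>{0..a}\<close> carrying most of \<open>f n a\<close> but almost nothing
  of the earlier functionals. The tail suprema \<open>s n\<close> of the \<open>v k\<close> exist and their differences tend to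
  \<open>0\<close>, although \<open>f n\<close> is large at \<open>s n\<close> and small at \<open>s (Suc n)\<close>.\<close>

lemma disjoint_functionals_null_at:
  fixes f :: "nat \<Rightarrow> 'a::banach_lattice \<Rightarrow>\<^sub>L real"
  assumes L: "L_weakly_compact {0..a}" and f: "\<And>n. 0 \<le> f n" "\<And>n. norm (f n) \<le> 1"
    and disj: "\<And>m n. m \<noteq> n \<Longrightarrow> inf (f m) (f n) = 0"
  shows "(\<lambda>n. f n a) \<longlonglongrightarrow> 0"
proof (rule ccontr)
  assume no: "\<not> ?thesis"
  have a: "0 \<le> a" using L by (auto simp: L_weakly_compact_def)
  have fa: "0 \<le> f n a" for n using f(1)[of n] a by (simp add: less_eq_blinfun_def)
  obtain e r where e: "0 < e" and r: "strict_mono (r :: nat \<Rightarrow> nat)" and ge: "\<And>n. e \<le> f (r n) a"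
    using fa no by (rule not_null_subseq) blast
  define g where "g = (\<lambda>n. f (r n))"
  have g0: "0 \<le> g n" for n using f by (simp add: g_def)
  have g1: "norm (g n) \<le> 1" for n using f by (simp add: g_def)
  \<comment> \<open>\<open>g n\<close> is disjoint from the sum of all earlier functionals. The
    geometric tolerance makes the values of \<open>g i\<close> at all later \<open>v n\<close> add
    up to at most \<open>e / 8\<close>.\<close>
  have "\<exists>v\<in>{0..a}. g n (a - v) + (\<Sum>i<n. g i v) < e / 8 * (1/2)^n" for n
  proof -
    have "inf (g n) (\<Sum>i<n. g i) \<le> (\<Sum>i<n. inf (g n) (g i))"
      using g0 by (intro inf_sum_le) auto
    also have "\<dots> = 0" using r by (intro sum.neutral) (auto simp: g_def strict_mono_eq intro!: disj)
    finally have "inf (g n) (\<Sum>i<n. g i) = 0"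
      using g0 by (intro order.antisym) (auto intro!: sum_nonneg)
    moreover have "0 < e / 8 * (1/2)^n" using e by simp
    ultimately obtain v where "v \<in> {0..a}" "g n (a - v) + (\<Sum>i<n. g i) v < e / 8 * (1/2)^n"
      using a by (metis disjoint_functionals_split)
    then show ?thesis by (auto simp: blinfun.sum_left)
  qed
  then obtain v where v: "\<And>n. v n \<in> {0..a}"
    and gv: "\<And>n. g n (a - v n) + (\<Sum>i<n. g i (v n)) < e / 8 * (1/2)^n"
    by metis
  have gx: "0 \<le> g n x" if "0 \<le> x" for n x using g0 that by (auto simp: less_eq_blinfun_def)
  have big: "e - e / 8 \<le> g n (v n)" for n
  proof -
    have "0 \<le> (\<Sum>i<n. g i (v n))" using gx v by (intro sum_nonneg) auto
    moreover have "e / 8 * (1/2)^n \<le> e / 8 * 1"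
      using e by (intro mult_left_mono power_le_one) auto
    ultimately have "g n (a - v n) \<le> e / 8" using gv[of n] by linarith
    then show ?thesis using ge[of n] by (simp add: g_def blinfun.diff_right)
  qed
  have small: "g i (v n) \<le> e / 8 * (1/2)^n" if "i < n" for i n
  proof -
    have "g i (v n) \<le> (\<Sum>i<n. g i (v n))"
      using gx v that by (intro member_le_sum[of i]) auto
    moreover have "0 \<le> g n (a - v n)" using gx v by auto
    ultimately show ?thesis using gv[of n] by linarith
  qed
  \<comment> \<open>\<open>t n N\<close> is the supremum of \<open>0\<close> and the first
    \<open>N\<close> of the elements \<open>v n\<close>, \<open>v (n + 1)\<close>, and so on; its
    norm limit in \<open>N\<close> serves as the tail supremum.\<close>
  define t where "t n = rec_nat 0 (\<lambda>k s. sup s (v (n + k)))" for n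
  have t0: "t n 0 = 0" and tS: "t n (Suc N) = sup (t n N) (v (n + N))" for n N
    by (simp_all add: t_def)
  have t_nonneg: "0 \<le> t n N" for n N by (induction N) (auto simp: t0 tS intro: le_supI1)
  have t_le: "t n N \<le> b" if "0 \<le> b" "\<And>k. n \<le> k \<Longrightarrow> v k \<le> b" for n N b
    by (induction N) (use that in \<open>auto simp: t0 tS\<close>)
  have t_sum: "t n N \<le> (\<Sum>k<N. v (n + k))" for n N
  proof (induction N)
    case (Suc N)
    have "0 \<le> v (n + N)" "0 \<le> (\<Sum>k<N. v (n + k))" using v by (auto intro!: sum_nonneg)
    with Suc show ?case by (auto simp: tS intro: add_increasing add_increasing2)
  qed (simp add: t0)
  have t_inc: "incseq (t n)" for n by (rule incseq_SucI) (simp add: tS)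
  have t_ge: "v (n + k) \<le> t n N" if "Suc k \<le> N" for n k N
    using incseqD[OF t_inc that, of n] by (simp add: tS)
  have ta: "t n N \<in> {0..a}" for n N using t_nonneg t_le[of a n N] a v by auto
  have "convergent (t n)" for n
    using incseq_Cauchy[OF L ta t_inc] by (rule Cauchy_convergent)
  then obtain s where s: "\<And>n. t n \<longlonglongrightarrow> s n" unfolding convergent_def by metis
  have s_ge: "v k \<le> s n" if "n \<le> k" for n k
    using t_ge[of "k - n" _ n] that by (intro tendsto_lowerbound_lattice[OF s]) auto
  have s_nonneg: "0 \<le> s n" for n by (rule tendsto_lowerbound_lattice[OF s t_nonneg])
  have s_le: "s n \<le> a" for n using ta by (intro tendsto_upperbound_lattice[OF s]) auto
  have s_dec: "s (Suc n) \<le> s n" for n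
    using s_ge s_nonneg by (intro tendsto_upperbound_lattice[OF s] t_le) auto
  \<comment> \<open>A finite supremum of nonnegative elements is at most their sum, so the geometric
    bounds on \<open>g n (v k)\<close> for \<open>k > n\<close> pass to the tail supremum.\<close>
  have gs: "g n (s (Suc n)) \<le> e / 8" for n
  proof (rule LIMSEQ_le_const2)
    show "(\<lambda>N. g n (t (Suc n) N)) \<longlonglongrightarrow> g n (s (Suc n))" by (intro tendsto_intros s)
    have "g n (t (Suc n) N) \<le> e / 8" for N
    proof -
      have "g n (t (Suc n) N) \<le> g n (\<Sum>k<N. v (Suc n + k))"
        by (intro nonneg_blinfun_mono g0 t_sum)
      also have "\<dots> = (\<Sum>k<N. g n (v (Suc n + k)))" by (rule blinfun.sum_right)
      also have "\<dots> \<le> (\<Sum>k<N. e / 8 * (1/2)^(Suc n + k))" by (intro sum_mono small) simp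
      also have "\<dots> \<le> (\<Sum>k<N. e / 8 * (1/2)^Suc k)"
        using e by (intro sum_mono mult_left_mono power_decreasing) auto
      also have "\<dots> = e / 8 * (\<Sum>k<N. (1/2)^Suc k)" by (simp only: sum_distrib_left)
      also have "(\<Sum>k<N. (1/2::real)^Suc k) = 1 - (1/2)^N" by (induction N) auto
      also have "e / 8 * (1 - (1/2)^N) \<le> e / 8 * 1" using e by (intro mult_left_mono) auto
      finally show ?thesis by simp
    qed
    then show "\<exists>N. \<forall>n'\<ge>N. g n (t (Suc n) n') \<le> e / 8" by blast
  qed
  have "(\<lambda>n. norm (s n - s (Suc n))) \<longlonglongrightarrow> 0"
  proof (rule bounded_sums_null[OF L])
    show "0 \<le> s n - s (Suc n)" for n using s_dec by simp
    show "(\<Sum>n<N. s n - s (Suc n)) \<le> a" for N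
    proof -
      have "s 0 \<le> a + s N" using s_nonneg s_le by (auto intro: add_increasing2)
      then show ?thesis by (simp add: sum_lessThan_telescope' algebra_simps)
    qed
  qed
  moreover have "e / 2 \<le> norm (s n - s (Suc n))" for n
  proof -
    have "e - e / 8 \<le> g n (s n)"
      using big[of n] nonneg_blinfun_mono[OF g0 s_ge[of n n], of n] by simp
    then have "e / 2 \<le> g n (s n - s (Suc n))"
      using gs[of n] e by (simp add: blinfun.diff_right)
    also have "\<dots> \<le> norm (s n - s (Suc n))" by (rule blinfun_le_norm[OF g1])
    finally show ?thesis .
  qed
  ultimately have "e / 2 \<le> 0" by (intro LIMSEQ_le_const) auto
  with e show False by simp
qed

text \<open>Bounding \<open>f n (a n)\<close> by \<open>\<bar>f n\<bar> \<bar>a n\<bar>\<close>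
  makes everything positive, so that the \<open>\<bar>a n\<bar>\<close> can be disjointified inside
  the solid hull of \<open>A\<close>.\<close>

lemma L_weakly_compact_disjoint_functionals_null:
  fixes f :: "nat \<Rightarrow> 'a::banach_lattice \<Rightarrow>\<^sub>L real"
  assumes L: "L_weakly_compact A" and a: "\<And>n. a n \<in> A"
    and f: "disjoint_seq f" "range f \<subseteq> cball 0 1"
  shows "(\<lambda>n. f n (a n)) \<longlonglongrightarrow> 0"
proof -
  have nf: "norm (f n) \<le> 1" for n using f(2) by (auto simp: image_subset_iff)
  have "(\<lambda>n. \<bar>f n\<bar> \<bar>a n\<bar>) \<longlonglongrightarrow> 0"
  proof (rule ccontr)
    assume no: "\<not> ?thesis"
    have "0 \<le> \<bar>f n\<bar> \<bar>a n\<bar>" for n by (rule order_trans[OF abs_ge_zero abs_blinfun_le])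
    then obtain e r where e: "0 < e" and r: "strict_mono (r :: nat \<Rightarrow> nat)"
      and ge: "\<And>n. e \<le> \<bar>f (r n)\<bar> \<bar>a (r n)\<bar>"
      using no by (rule not_null_subseq) blast
    have "(\<lambda>n. \<bar>f (r n)\<bar> \<bar>a (r i)\<bar>) \<longlonglongrightarrow> 0" for i
    proof (rule disjoint_functionals_null_at)
      show "L_weakly_compact {0..\<bar>a (r i)\<bar>}" using L a by (rule L_weakly_compact_interval)
      show "inf \<bar>f (r m)\<bar> \<bar>f (r n)\<bar> = 0" if "m \<noteq> n" for m n
        using disjoint_seq_subseq[OF f(1) r] that by (auto simp: disjoint_seq_def)
    qed (auto simp: norm_abs_lattice nf)
    then obtain s where s: "strict_mono s" and
      small: "\<And>i j. i < j \<Longrightarrow> \<bar>f (r (s j))\<bar> \<bar>a (r (s i))\<bar> < (1/8)^j / real (Suc j)"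
      by (rule diagonal_subseq[where b="\<lambda>i n. \<bar>f (r n)\<bar> \<bar>a (r i)\<bar>"
            and \<delta>="\<lambda>j. (1/8)^j / real (Suc j)"]) auto
    define g where "g = (\<lambda>n. \<bar>f (r (s n))\<bar>)"
    define c where "c = (\<lambda>n. \<bar>a (r (s n))\<bar>)"
    have g0: "0 \<le> g n" and g1: "norm (g n) \<le> 1" and c0: "0 \<le> c n" for n
      using nf by (auto simp: g_def c_def norm_abs_lattice)
    obtain C where "\<And>x. x \<in> A \<Longrightarrow> norm x \<le> C"
      using L unfolding L_weakly_compact_def bounded_iff by blast
    then have "norm (c n) \<le> C" for n using a by (simp add: c_def norm_abs_lattice)
    with c0 obtain y where y: "\<And>k. (1/2)^k *\<^sub>R c k \<le> y" 
      by (rule weighted_upper_bound[where x=c and C=C]) blast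
    have y0: "0 \<le> y" using c0[of 0] y[of 0] by simp
    define D where "D = disjointify c y"
    have "disjoint_seq D" unfolding D_def using c0 y by (rule disjoint_seq_disjointify)
    moreover have "D n \<in> solid_hull A" for n
      using disjointify_le[of c y n] c0 y0 a unfolding solid_hull_def
      by (auto simp: D_def c_def disjointify_nonneg abs_of_nonneg)
    ultimately have D0: "(\<lambda>n. norm (D n)) \<longlonglongrightarrow> 0" using L unfolding L_weakly_compact_def by blast
    \<comment> \<open>In the decomposition of \<open>c n\<close>, the earlier elements contribute
      little to \<open>g n (c n)\<close> by the diagonal choice, and the disjoint part
      \<open>D n\<close> at most its norm.\<close>
    have "e \<le> (1/2)^n + norm (D n) + (1/2)^n * norm y" for n
    proof -
      have "c n \<le> 4^n *\<^sub>R (\<Sum>i<n. c i) + D n + (1/2)^n *\<^sub>R y"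
        using le_disjointify[of c y n] c0 y0 unfolding D_def
        by (auto elim!: order_trans intro!: add_right_mono)
      then have "g n (c n) \<le> g n (4^n *\<^sub>R (\<Sum>i<n. c i) + D n + (1/2)^n *\<^sub>R y)"
        using g0 by (intro nonneg_blinfun_mono)
      also have "\<dots> = 4^n * (\<Sum>i<n. g n (c i)) + g n (D n) + (1/2)^n * g n y"
        by (simp add: blinfun.add_right blinfun.scaleR_right blinfun.sum_right)
      also have "\<dots> \<le> 4^n * (\<Sum>i<n. (1/8)^n / real (Suc n)) + norm (D n) + (1/2)^n * norm y"
        using small by (intro add_mono mult_left_mono sum_mono blinfun_le_norm[OF g1])
          (auto simp: g_def c_def less_imp_le)
      also have "4^n * (\<Sum>i<n. (1/8::real)^n / real (Suc n)) = (1/2)^n * (n / Suc n)"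
        by (simp flip: power_mult_distrib)
      also have "\<dots> \<le> (1/2)^n * 1" by (intro mult_left_mono) auto
      finally have "g n (c n) \<le> (1/2)^n + norm (D n) + (1/2)^n * norm y" by simp
      then show ?thesis using ge[of "s n"] by (simp add: g_def c_def)
    qed
    moreover have "(\<lambda>n. (1/2)^n + norm (D n) + (1/2)^n * norm y) \<longlonglongrightarrow> 0 + 0 + 0 * norm y"
      by (intro tendsto_intros D0 LIMSEQ_power_zero) auto
    ultimately have "e \<le> 0" by (intro LIMSEQ_le_const) auto
    with e show False by simp
  qed
  then show ?thesis by (rule Lim_null_comparison[rotated]) (simp add: abs_blinfun_le)
qed

section \<open>Norming functionals localized at an element\<close>

text \<open>Homogeneity is asked for as an inequality, which is convenient to check for suprema and
  infima; rescaling by \<open>1/c\<close> gives equality.\<close>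

definition sublinear :: "('a::real_vector \<Rightarrow> real) \<Rightarrow> bool"
  where "sublinear p \<longleftrightarrow>
    (\<forall>x y. p (x + y) \<le> p x + p y) \<and> (\<forall>c x. 0 < c \<longrightarrow> p (c *\<^sub>R x) \<le> c * p x)"

lemma sublinearD:
  assumes "sublinear p"
  shows "p (x + y) \<le> p x + p y" "0 < c \<Longrightarrow> p (c *\<^sub>R x) = c * p x" "p 0 = 0" "- p (- x) \<le> p x"
proof -
  show add: "p (x + y) \<le> p x + p y" for x y using assms by (simp add: sublinear_def)
  have scale: "p (c *\<^sub>R x) \<le> c * p x" if "0 < c" for c x using assms that by (simp add: sublinear_def)
  show "p (c *\<^sub>R x) = c * p x" if "0 < c"
    using scale[of c x] scale[of "1/c" "c *\<^sub>R x"] that by (simp add: field_simps)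
  show 0: "p 0 = 0" using add[of 0 0] scale[of "1/2" 0] by simp
  show "- p (- x) \<le> p x" using add[of x "- x"] 0 by simp
qed

text \<open>For \<open>t > 0\<close> the expression is the difference quotient of a sublinear
  \<open>p\<close> at \<open>w\<close> in direction \<open>y\<close> with step \<open>1/t\<close>,
  so the infimum is the one-sided directional derivative of \<open>p\<close> at
  \<open>w\<close>.\<close>

definition directional :: "('a::real_vector \<Rightarrow> real) \<Rightarrow> 'a \<Rightarrow> 'a \<Rightarrow> real"
  where "directional p w y = (INF t\<in>{0..}. p (y + t *\<^sub>R w) - t * p w)"

lemma directional_le:
  assumes p: "sublinear p" and t: "0 \<le> t"
  shows "directional p w y \<le> p (y + t *\<^sub>R w) - t * p w"
  unfolding directional_def
proof (rule cINF_lower)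
  have "- p (- y) \<le> p (y + t *\<^sub>R w) - t * p w" if "0 \<le> t" for t
  proof -
    have "t * p w = p (t *\<^sub>R w)" using sublinearD(2,3)[OF p] that by (cases "t = 0") auto
    also have "\<dots> \<le> p (y + t *\<^sub>R w) + p (- y)"
      using sublinearD(1)[OF p, of "y + t *\<^sub>R w" "- y"] by simp
    finally show ?thesis by simp
  qed
  then show "bdd_below ((\<lambda>t. p (y + t *\<^sub>R w) - t * p w) ` {0..})"
    by (intro bdd_belowI2[where m="- p (- y)"]) auto
qed (use t in simp)

lemma directional_greatest:
  assumes "\<And>t. 0 \<le> t \<Longrightarrow> b \<le> p (y + t *\<^sub>R w) - t * p w"
  shows "b \<le> directional p w y"
  unfolding directional_def using assms by (intro cINF_greatest) auto

lemma directional_below: "sublinear p \<Longrightarrow> directional p w y \<le> p y"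
  using directional_le[of p 0 w y] by simp

lemma directional_uminus: "sublinear p \<Longrightarrow> directional p w (- w) \<le> - p w"
  using directional_le[of p 1 w "- w"] by (simp add: sublinearD(3))

text \<open>Parameters \<open>t\<close> for \<open>x\<close> and \<open>s\<close> for
  \<open>y\<close> combine to \<open>t + s\<close> for \<open>x + y\<close>, and \<open>t\<close>
  for \<open>x\<close> becomes \<open>c * t\<close> for \<open>c *\<^sub>R x\<close>.\<close>

lemma sublinear_directional:
  assumes p: "sublinear p"
  shows "sublinear (directional p w)"
  unfolding sublinear_def
proof (intro conjI allI impI)
  fix x y
  have "directional p w (x + y) - directional p w y \<le> directional p w x"
  proof (rule directional_greatest)
    fix t :: real assume t: "0 \<le> t"
    have "directional p w (x + y) - (p (x + t *\<^sub>R w) - t * p w) \<le> directional p w y"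
    proof (rule directional_greatest)
      fix s :: real assume s: "0 \<le> s"
      have "p (x + y + (t + s) *\<^sub>R w) \<le> p (x + t *\<^sub>R w) + p (y + s *\<^sub>R w)"
        using sublinearD(1)[OF p, of "x + t *\<^sub>R w" "y + s *\<^sub>R w"] by (simp add: algebra_simps)
      then show "directional p w (x + y) - (p (x + t *\<^sub>R w) - t * p w) \<le> p (y + s *\<^sub>R w) - s * p w"
        using directional_le[OF p, of "t + s" w "x + y"] s t by (simp add: algebra_simps)
    qed
    then show "directional p w (x + y) - directional p w y \<le> p (x + t *\<^sub>R w) - t * p w" by simp
  qed
  then show "directional p w (x + y) \<le> directional p w x + directional p w y" by simp
next
  fix c :: real and x assume c: "0 < c"
  have "directional p w (c *\<^sub>R x) / c \<le> directional p w x"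
  proof (rule directional_greatest)
    fix t :: real assume t: "0 \<le> t"
    have "p (c *\<^sub>R x + (c * t) *\<^sub>R w) = c * p (x + t *\<^sub>R w)"
      using sublinearD(2)[OF p c, of "x + t *\<^sub>R w"] by (simp add: scaleR_right_distrib)
    then have "directional p w (c *\<^sub>R x) \<le> c * (p (x + t *\<^sub>R w) - t * p w)"
      using directional_le[OF p, of "c * t" w "c *\<^sub>R x"] c t by (simp add: algebra_simps)
    then show "directional p w (c *\<^sub>R x) / c \<le> p (x + t *\<^sub>R w) - t * p w"
      using c by (simp add: field_simps)
  qed
  then show "directional p w (c *\<^sub>R x) \<le> c * directional p w x" using c by (simp add: field_simps)
qed

text \<open>For subadditivity, \<open>q x + r y\<close> with two members \<open>q\<close> and
  \<open>r\<close> only decreases when both are replaced by the smaller one, which exists in a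
  chain. The bound \<open>- p (- x)\<close> makes the pointwise infima meaningful.\<close>

lemma sublinear_INF_chain:
  assumes C: "C \<noteq> {}" "\<And>q. q \<in> C \<Longrightarrow> sublinear q" "\<And>q. q \<in> C \<Longrightarrow> q \<le> p"
    and chain: "\<And>q r. q \<in> C \<Longrightarrow> r \<in> C \<Longrightarrow> q \<le> r \<or> r \<le> q"
  shows "sublinear (\<lambda>x. INF q\<in>C. q x)" "q \<in> C \<Longrightarrow> (INF q\<in>C. q x) \<le> q x"
proof -
  have "- p (- x) \<le> q x" if "q \<in> C" for q x
  proof -
    have "- p (- x) \<le> - q (- x)" using C(3)[OF that] by (simp add: le_fun_def)
    also have "\<dots> \<le> q x" using C(2)[OF that] by (rule sublinearD)
    finally show ?thesis .
  qed
  then have "bdd_below ((\<lambda>q. q x) ` C)" for x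
    by (intro bdd_belowI2[where m="- p (- x)"]) auto
  then show lower: "(INF q\<in>C. q x) \<le> q x" if "q \<in> C" for q x
    using that by (intro cINF_lower)
  show "sublinear (\<lambda>x. INF q\<in>C. q x)"
    unfolding sublinear_def
  proof (intro conjI allI impI)
    fix x y
    have le: "(INF q\<in>C. q (x + y)) \<le> q x + r y" if q: "q \<in> C" and r: "r \<in> C" for q r
    proof -
      obtain s where s: "s \<in> C" "s \<le> q" "s \<le> r" using chain[OF q r] q r by blast
      have "(INF q\<in>C. q (x + y)) \<le> s (x + y)" using s(1) by (rule lower)
      also have "\<dots> \<le> s x + s y" using C(2)[OF s(1)] by (rule sublinearD)
      also have "\<dots> \<le> q x + r y" using s by (auto simp: le_fun_def intro: add_mono)
      finally show ?thesis .
    qed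
    have "(INF q\<in>C. q (x + y)) - (INF q\<in>C. q y) \<le> (INF q\<in>C. q x)"
    proof (rule cINF_greatest[OF C(1)])
      fix q assume q: "q \<in> C"
      have "(INF q\<in>C. q (x + y)) - q x \<le> (INF q\<in>C. q y)"
        by (rule cINF_greatest[OF C(1)]) (use le[OF q] in \<open>simp add: algebra_simps\<close>)
      then show "(INF q\<in>C. q (x + y)) - (INF q\<in>C. q y) \<le> q x" by simp
    qed
    then show "(INF q\<in>C. q (x + y)) \<le> (INF q\<in>C. q x) + (INF q\<in>C. q y)" by simp
  next
    fix c :: real and x assume c: "0 < c"
    have "(INF q\<in>C. q (c *\<^sub>R x)) / c \<le> (INF q\<in>C. q x)"
    proof (rule cINF_greatest[OF C(1)])
      fix q assume q: "q \<in> C"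
      have "(INF q\<in>C. q (c *\<^sub>R x)) \<le> c * q x"
        using lower[OF q, of "c *\<^sub>R x"] sublinearD(2)[OF C(2)[OF q] c] by simp
      then show "(INF q\<in>C. q (c *\<^sub>R x)) / c \<le> q x" using c by (simp add: field_simps)
    qed
    then show "(INF q\<in>C. q (c *\<^sub>R x)) \<le> c * (INF q\<in>C. q x)" using c by (simp add: field_simps)
  qed
qed

text \<open>A minimal sublinear functional \<open>m\<close> coincides with each \<open>directional m w\<close>, hence
  \<open>m (- w) \<le> - m w\<close>, which makes it linear.\<close>

lemma Hahn_Banach_sublinear:
  fixes p :: "'a::real_vector \<Rightarrow> real"
  assumes p: "sublinear p"
  obtains f where "linear f" "\<And>x. f x \<le> p x" "f w = p w"
proof -
  \<comment> \<open>Minimizing below \<open>directional p w\<close> rather than \<open>p\<close>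
    forces the value at \<open>- w\<close> to be at most \<open>- p w\<close>, which yields
    \<open>f w = p w\<close>.\<close>
  define q where "q = directional p w"
  define S where "S = {r. sublinear r \<and> r \<le> q}"
  have q: "sublinear q" unfolding q_def by (rule sublinear_directional[OF p])
  have "\<exists>m\<in>S. \<forall>a\<in>S. a \<le> m \<longrightarrow> a = m"
  proof (rule predicate_Zorn)
    show "partial_order_on S (relation_of (\<lambda>a b. b \<le> a) S)"
      by (rule partial_order_on_relation_ofI) auto
    fix C assume "C \<in> Chains (relation_of (\<lambda>a b. b \<le> a) S)"
    then have C: "C \<subseteq> S" "\<And>r s. r \<in> C \<Longrightarrow> s \<in> C \<Longrightarrow> r \<le> s \<or> s \<le> r"
      unfolding Chains_def relation_of_def by blast+
    show "\<exists>u\<in>S. \<forall>a\<in>C. u \<le> a"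
    proof (cases "C = {}")
      case False
      have inC: "\<And>r. r \<in> C \<Longrightarrow> sublinear r" "\<And>r. r \<in> C \<Longrightarrow> r \<le> q"
        using C(1) by (auto simp: S_def)
      define u where "u = (\<lambda>x. INF r\<in>C. r x)"
      have u: "sublinear u" "\<And>r. r \<in> C \<Longrightarrow> u \<le> r"
        unfolding u_def le_fun_def using sublinear_INF_chain[OF False inC C(2)] by blast+
      then have "u \<le> q" using False inC(2) order_trans by blast
      with u show ?thesis by (auto simp: S_def)
    qed (use q in \<open>auto simp: S_def\<close>)
  qed
  then obtain m where m: "sublinear m" "m \<le> q"
    and min: "\<And>r. sublinear r \<Longrightarrow> r \<le> m \<Longrightarrow> r = m"
    unfolding S_def by (blast intro: order_trans)
  have neg: "m (- x) = - m x" for x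
  proof (rule order.antisym)
    have "directional m x = m"
      using m(1) by (intro min sublinear_directional) (auto simp: le_fun_def directional_below)
    then show "m (- x) \<le> - m x" using directional_uminus[OF m(1), of x] by simp
    show "- m x \<le> m (- x)" using sublinearD(4)[OF m(1), of "- x"] by simp
  qed
  show thesis
  proof (rule that)
    show "linear m"
    proof (rule linearI)
      show "m (x + y) = m x + m y" for x y
        using sublinearD(1)[OF m(1), of x y] sublinearD(1)[OF m(1), of "- x" "- y"] neg[of "x + y"]
        by (simp add: neg)
      have pos: "m (c *\<^sub>R x) = c * m x" if "0 < c" for c x using sublinearD(2)[OF m(1) that] .
      show "m (c *\<^sub>R x) = c *\<^sub>R m x" for c x
        using pos[of c x] pos[of "- c" x] neg[of "c *\<^sub>R x"] sublinearD(3)[OF m(1)]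
        by (cases c "0::real" rule: linorder_cases) auto
    qed
    show le: "m x \<le> p x" for x
      using m(2) directional_below[OF p, of w x] by (auto simp: le_fun_def q_def intro: order_trans)
    have "m (- w) \<le> - p w"
      using m(2) directional_uminus[OF p, of w] by (auto simp: le_fun_def q_def intro: order_trans)
    then show "m w = p w" using le[of w] neg[of w] by simp
  qed
qed

text \<open>Hahn-Banach is applied to a sublinear \<open>p\<close> that measures how much of
  \<open>pprt z\<close> lies under multiples of \<open>w\<close>. It is at most
  \<open>norm z\<close>, reaches \<open>norm w\<close> at \<open>w\<close>, and vanishes at
  nonpositive \<open>z\<close> and at nonnegative \<open>z\<close> disjoint from \<open>w\<close>;
  this gives the norm bound, positivity and localization.\<close>

lemma localized_functional:
  fixes w :: "'a::banach_lattice"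
  assumes w: "0 \<le> w"
  obtains \<phi> :: "'a \<Rightarrow>\<^sub>L real" where "0 \<le> \<phi>" "norm \<phi> \<le> 1" "\<phi> w = norm w"
    "\<And>z. 0 \<le> z \<Longrightarrow> inf z w = 0 \<Longrightarrow> \<phi> z = 0"
proof -
  define p where "p z = (SUP t\<in>{0..}. norm (inf (pprt z) (t *\<^sub>R w)))" for z
  have tw: "0 \<le> t *\<^sub>R w" if "0 \<le> t" for t using w that by (intro scaleR_nonneg_nonneg)
  have le_norm: "norm (inf (pprt z) (t *\<^sub>R w)) \<le> norm z" if "0 \<le> t" for z t
    using norm_mono_nonneg[of "inf (pprt z) (t *\<^sub>R w)" "pprt z"] norm_pprt[of z] tw[OF that]
    by simp
  then have bdd: "bdd_above ((\<lambda>t. norm (inf (pprt z) (t *\<^sub>R w))) ` {0..})" for z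
    by (intro bdd_aboveI2[where M="norm z"]) auto
  have upper: "norm (inf (pprt z) (t *\<^sub>R w)) \<le> p z" if "0 \<le> t" for z t
    unfolding p_def using that by (intro cSUP_upper bdd) auto
  have least: "p z \<le> b" if "\<And>t. 0 \<le> t \<Longrightarrow> norm (inf (pprt z) (t *\<^sub>R w)) \<le> b" for z b
    unfolding p_def using that by (intro cSUP_least) auto
  have "sublinear p"
    unfolding sublinear_def
  proof (intro conjI allI impI)
    fix x y
    show "p (x + y) \<le> p x + p y"
    proof (rule least)
      fix t :: real assume t: "0 \<le> t"
      have "pprt (x + y) \<le> pprt x + pprt y" by (intro pprt_le add_mono pprt_ge) auto
      then have "inf (pprt (x + y)) (t *\<^sub>R w) \<le> inf (t *\<^sub>R w) (pprt x + pprt y)"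
        by (auto intro: le_infI1)
      also have "\<dots> \<le> inf (pprt x) (t *\<^sub>R w) + inf (pprt y) (t *\<^sub>R w)"
        using inf_add_le[of "t *\<^sub>R w" "pprt x" "pprt y"] tw[OF t] by (simp add: inf_commute)
      finally have "norm (inf (pprt (x + y)) (t *\<^sub>R w))
          \<le> norm (inf (pprt x) (t *\<^sub>R w) + inf (pprt y) (t *\<^sub>R w))"
        using tw[OF t] by (intro norm_mono_nonneg) auto
      also have "\<dots> \<le> p x + p y"
        using t by (intro order_trans[OF norm_triangle_ineq] add_mono upper)
      finally show "norm (inf (pprt (x + y)) (t *\<^sub>R w)) \<le> p x + p y" .
    qed
  next
    fix c :: real and x assume c: "0 < c"
    show "p (c *\<^sub>R x) \<le> c * p x"
    proof (rule least)
      fix t :: real assume t: "0 \<le> t"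
      let ?i = "inf (pprt (c *\<^sub>R x)) (t *\<^sub>R w)"
      have i0: "0 \<le> (1/c) *\<^sub>R ?i" using c tw[OF t] by (intro scaleR_nonneg_nonneg) auto
      have "c *\<^sub>R x \<le> c *\<^sub>R pprt x" using c by (intro scaleR_left_mono pprt_ge) auto
      then have "pprt (c *\<^sub>R x) \<le> c *\<^sub>R pprt x"
        using c by (intro pprt_le scaleR_nonneg_nonneg) auto
      then have "(1/c) *\<^sub>R ?i \<le> (1/c) *\<^sub>R (c *\<^sub>R pprt x)"
        using c by (intro scaleR_left_mono) (auto intro: le_infI1)
      moreover have "(1/c) *\<^sub>R ?i \<le> (1/c) *\<^sub>R (t *\<^sub>R w)" using c by (intro scaleR_left_mono) auto
      ultimately have "(1/c) *\<^sub>R ?i \<le> inf (pprt x) ((t / c) *\<^sub>R w)" using c by simp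
      then have "norm ((1/c) *\<^sub>R ?i) \<le> norm (inf (pprt x) ((t / c) *\<^sub>R w))"
        using i0 by (intro norm_mono_nonneg)
      also have "\<dots> \<le> p x" using c t by (intro upper) auto
      finally show "norm ?i \<le> c * p x" using c by (simp add: field_simps)
    qed
  qed
  then obtain f where f: "linear f" "\<And>x. f x \<le> p x" "f w = p w"
    by (rule Hahn_Banach_sublinear[where p=p and w=w]) blast
  have fn: "f z \<le> norm z" for z using f(2)[of z] least[of z "norm z"] le_norm by (meson order_trans)
  have fabs: "norm (f z) \<le> norm z" for z
    using fn[of z] fn[of "- z"] linear_neg[OF f(1), of z] by (simp add: abs_le_iff)
  have "bounded_linear f"
    using f(1) fabs by (intro bounded_linear_intro[where K=1]) (auto simp: linear_add linear_cmul)
  then have ap: "blinfun_apply (Blinfun f) = f" by (rule bounded_linear_Blinfun_apply)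
  have nonneg: "0 \<le> f z" if "0 \<le> z" for z
  proof -
    have "p (- z) \<le> 0" using that tw by (intro least) (simp add: inf_absorb1)
    then show ?thesis using f(2)[of "- z"] linear_neg[OF f(1), of z] by simp
  qed
  show thesis
  proof (rule that[of "Blinfun f"])
    show "0 \<le> Blinfun f" using nonneg by (simp add: less_eq_blinfun_def ap)
    show "norm (Blinfun f) \<le> 1" using fabs by (intro norm_blinfun_bound) (auto simp: ap)
    have "f w = norm w" using upper[of 1 w] w f(3) fn[of w] by simp
    then show "Blinfun f w = norm w" by (simp add: ap)
    fix z assume z: "0 \<le> z" "inf z w = 0"
    have "p z \<le> 0"
    proof (rule least)
      fix t :: real assume t: "0 \<le> t"
      have "inf z (t *\<^sub>R w) \<le> inf z (max 1 t *\<^sub>R w)"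
        using w by (intro inf_mono scaleR_right_mono) auto
      also have "\<dots> \<le> max 1 t *\<^sub>R inf z w" using z w by (intro inf_scaleR_le) auto
      finally have "inf z (t *\<^sub>R w) = 0" using z tw[OF t] by (intro order.antisym) auto
      then show "norm (inf (pprt z) (t *\<^sub>R w)) \<le> 0" using z by simp
    qed
    then show "Blinfun f z = 0" using f(2)[of z] nonneg[OF z(1)] by (simp add: ap)
  qed
qed

section \<open>Order L-weakly compact operators\<close>

lemma order_L_weakly_compact_imp_null:
  fixes T :: "'e::banach_lattice \<Rightarrow>\<^sub>L 'f::banach_lattice" and f :: "nat \<Rightarrow> 'f \<Rightarrow>\<^sub>L real"
  assumes T: "order_L_weakly_compact T" and x: "order_bounded_seq x"
    and f: "disjoint_seq f" "range f \<subseteq> cball 0 1"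
  shows "(\<lambda>n. blinfun_apply (f n) (blinfun_apply T (x n))) \<longlonglongrightarrow> 0"
proof -
  obtain a b where ab: "\<And>n. a \<le> x n" "\<And>n. x n \<le> b"
    using x by (fastforce simp: order_bounded_seq_def)
  have pos: "(\<lambda>n. f n (T (y n))) \<longlonglongrightarrow> 0" if "\<And>n. y n \<in> {0..c}" for y c
  proof (rule L_weakly_compact_disjoint_functionals_null[OF _ _ f])
    have "0 \<le> c" using that[of 0] by auto
    then show "L_weakly_compact (T ` {0..c})" using T by (simp add: order_L_weakly_compact_def)
    show "T (y n) \<in> T ` {0..c}" for n using that by blast
  qed
  \<comment> \<open>The hypothesis on \<open>T\<close> concerns intervals starting at
    \<open>0\<close>, so \<open>x n\<close> is written as \<open>x n - a\<close> plus
    \<open>pprt a\<close> minus \<open>- nprt a\<close>, each nonnegative with a fixed upper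
    bound.\<close>
  have "(\<lambda>n. f n (T (x n - a)) + f n (T (pprt a)) - f n (T (- nprt a))) \<longlonglongrightarrow> 0 + 0 - 0"
    using ab by (intro tendsto_intros pos[of _ "b - a"] pos[of _ "pprt a"] pos[of _ "- nprt a"]) auto
  moreover have "f n (T (x n - a)) + f n (T (pprt a)) - f n (T (- nprt a)) = f n (T (x n))" for n
  proof -
    have "x n = (x n - a) + pprt a - (- nprt a)" using prts[of a] by (simp add: algebra_simps)
    then show ?thesis by (metis blinfun.add_right blinfun.diff_right)
  qed
  ultimately show ?thesis by simp
qed

lemma order_L_weakly_compactI:
  fixes T :: "'e::banach_lattice \<Rightarrow>\<^sub>L 'f::banach_lattice"
  assumes null: "\<And>x (f :: nat \<Rightarrow> 'f \<Rightarrow>\<^sub>L real). order_bounded_seq x \<Longrightarrow> disjoint_seq f \<Longrightarrow> range f \<subseteq> cball 0 1 \<Longrightarrow>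
    (\<lambda>n. blinfun_apply (f n) (blinfun_apply T (x n))) \<longlonglongrightarrow> 0"
  shows "order_L_weakly_compact T"
  unfolding order_L_weakly_compact_def L_weakly_compact_def
proof (intro allI impI conjI)
  fix x :: 'e assume x: "0 \<le> x"
  show "T ` {0..x} \<noteq> {}" using x by auto
  define K where "K = norm T * norm x"
  have K: "norm (T y) \<le> K" if "y \<in> {0..x}" for y
  proof -
    have "norm (T y) \<le> norm T * norm y" by (rule norm_blinfun)
    also have "\<dots> \<le> K" using that by (auto simp: K_def intro!: mult_left_mono norm_mono_nonneg)
    finally show ?thesis .
  qed
  then show "bounded (T ` {0..x})" unfolding bounded_iff by blast
  fix v assume "disjoint_seq v \<and> range v \<subseteq> solid_hull (T ` {0..x})"
  then have disj: "disjoint_seq v" and v: "\<And>n. v n \<in> solid_hull (T ` {0..x})" by auto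
  show "(\<lambda>n. norm (v n)) \<longlonglongrightarrow> 0"
  proof (rule ccontr)
    assume "\<not> ?thesis"
    then obtain e r where e: "0 < e" and r: "strict_mono (r :: nat \<Rightarrow> nat)"
      and ge: "\<And>n. e \<le> norm (v (r n))"
      by (rule not_null_subseq[OF norm_ge_zero]) blast
    have "\<exists>y\<in>{0..x}. \<bar>v (r n)\<bar> \<le> \<bar>T y\<bar>" for n using v[of "r n"] by (auto simp: solid_hull_def)
    then obtain y where y: "\<And>n. y n \<in> {0..x}" and vy: "\<And>n. \<bar>v (r n)\<bar> \<le> \<bar>T (y n)\<bar>" by metis
    \<comment> \<open>\<open>\<bar>T (y n)\<bar>\<close> is the sum of the positive parts of
      \<open>T (y n)\<close> and \<open>- T (y n)\<close>; subadditivity of the infimum leaves one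
      of the two pieces of \<open>\<bar>v (r n)\<bar>\<close> with norm at least
      \<open>e / 2\<close>.\<close>
    have "\<exists>u. (u = T (y n) \<or> u = - T (y n)) \<and> e / 2 \<le> norm (inf \<bar>v (r n)\<bar> (pprt u))" for n
    proof -
      have "\<bar>T (y n)\<bar> = pprt (T (y n)) + pprt (- T (y n))" by (simp add: abs_prts pprt_neg)
      then have "\<bar>v (r n)\<bar> = inf \<bar>v (r n)\<bar> (pprt (T (y n)) + pprt (- T (y n)))"
        using vy[of n] by (simp add: inf_absorb1)
      also have "\<dots> \<le> inf \<bar>v (r n)\<bar> (pprt (T (y n))) + inf \<bar>v (r n)\<bar> (pprt (- T (y n)))"
        by (intro inf_add_le) auto
      finally have "norm \<bar>v (r n)\<bar>
          \<le> norm (inf \<bar>v (r n)\<bar> (pprt (T (y n))) + inf \<bar>v (r n)\<bar> (pprt (- T (y n))))"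
        by (intro norm_mono_nonneg) auto
      also have "\<dots> \<le> norm (inf \<bar>v (r n)\<bar> (pprt (T (y n)))) + norm (inf \<bar>v (r n)\<bar> (pprt (- T (y n))))"
        by (rule norm_triangle_ineq)
      finally have "e \<le> norm (inf \<bar>v (r n)\<bar> (pprt (T (y n)))) + norm (inf \<bar>v (r n)\<bar> (pprt (- T (y n))))"
        using ge[of n] by (simp add: norm_abs_lattice)
      then show ?thesis by (metis add_mono_thms_linordered_field(5) field_sum_of_halves not_le)
    qed
    then obtain u where u: "\<And>n. u n = T (y n) \<or> u n = - T (y n)"
      and eu: "\<And>n. e / 2 \<le> norm (inf \<bar>v (r n)\<bar> (pprt (u n)))" by metis
    define w where "w n = inf \<bar>v (r n)\<bar> (pprt (u n))" for n
    have w0: "0 \<le> w n" and wu: "w n \<le> pprt (u n)" and wv: "w n \<le> \<bar>v (r n)\<bar>" for n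
      by (auto simp: w_def)
    have ww: "inf (w m) (w n) = 0" if "m \<noteq> n" for m n
      using disjoint_seq_subseq[OF disj r] that
      by (intro inf_eq_0_mono[OF _ w0 wv w0 wv]) (auto simp: disjoint_seq_def)
    have uw: "inf (pprt (- u n)) (w n) = 0" for n
      using inf_pprt_neg[of "- u n"] by (rule inf_eq_0_mono) (auto simp: w0 wu)
    have nw: "norm (w n) \<le> K" for n
    proof -
      have "norm (w n) \<le> norm (pprt (u n))" using w0 wu by (rule norm_mono_nonneg)
      also have "\<dots> \<le> norm (u n)" by (rule norm_pprt)
      also have "\<dots> \<le> K" using K[OF y[of n]] u[of n] by auto
      finally show ?thesis .
    qed
    have "\<exists>\<phi>. 0 \<le> \<phi> \<and> norm \<phi> \<le> 1 \<and> blinfun_apply \<phi> (w n) = norm (w n) \<and>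
      (\<forall>z. 0 \<le> z \<longrightarrow> inf z (w n) = 0 \<longrightarrow> blinfun_apply \<phi> z = 0)" for n
      using localized_functional[OF w0[of n]] by metis
    then obtain \<phi> where \<phi>: "\<And>n. 0 \<le> \<phi> n" "\<And>n. norm (\<phi> n) \<le> 1"
      "\<And>n. blinfun_apply (\<phi> n) (w n) = norm (w n)"
      "\<And>n z. 0 \<le> z \<Longrightarrow> inf z (w n) = 0 \<Longrightarrow> blinfun_apply (\<phi> n) z = 0"
      by metis
    \<comment> \<open>The \<open>\<phi> n\<close> are not yet known to be disjoint as functionals;
      \<open>\<Phi>\<close> prepares their disjointification in the dual.\<close>
    obtain \<Phi> where \<Phi>: "\<And>k. (1/2)^k *\<^sub>R \<phi> k \<le> \<Phi>"
      using \<phi>(1,2) by (rule weighted_upper_bound[where x=\<phi> and C=1]) blast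
    have \<Phi>0: "0 \<le> \<Phi>" using \<phi>(1)[of 0] \<Phi>[of 0] by simp
    define f where "f = disjointify \<phi> \<Phi>"
    have f0: "0 \<le> f n" for n unfolding f_def by (rule disjointify_nonneg)
    have f\<phi>: "f n \<le> \<phi> n" for n unfolding f_def by (rule disjointify_le[OF \<phi>(1) \<Phi>0])
    have "norm (f n) \<le> 1" for n using norm_mono_nonneg[OF f0 f\<phi>, of n] \<phi>(2)[of n] by simp
    then have "range f \<subseteq> cball 0 1" by auto
    moreover have "disjoint_seq f" unfolding f_def using \<phi>(1) \<Phi> by (rule disjoint_seq_disjointify)
    moreover have "order_bounded_seq y" using y unfolding order_bounded_seq_def by blast
    ultimately have "(\<lambda>n. f n (T (y n))) \<longlonglongrightarrow> 0" by (intro null)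
    then have lim: "(\<lambda>n. \<bar>f n (T (y n))\<bar> + (1/2)^n * (norm \<Phi> * K)) \<longlonglongrightarrow> \<bar>0\<bar> + 0 * (norm \<Phi> * K)"
      by (intro tendsto_intros LIMSEQ_power_zero) auto
    have "e / 2 \<le> \<bar>f n (T (y n))\<bar> + (1/2)^n * (norm \<Phi> * K)" for n
    proof -
      have "\<phi> n \<le> 4^n *\<^sub>R (\<Sum>i<n. \<phi> i) + f n + (1/2)^n *\<^sub>R \<Phi>"
        using le_disjointify[of \<phi> \<Phi> n] \<phi>(1) \<Phi>0 unfolding f_def
        by (auto elim!: order_trans intro!: add_right_mono)
      then have "\<phi> n (w n) \<le> (4^n *\<^sub>R (\<Sum>i<n. \<phi> i) + f n + (1/2)^n *\<^sub>R \<Phi>) (w n)"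
        using w0 by (simp add: less_eq_blinfun_def)
      also have "\<dots> = 4^n * (\<Sum>i<n. \<phi> i (w n)) + f n (w n) + (1/2)^n * \<Phi> (w n)"
        by (simp add: blinfun.add_left blinfun.scaleR_left blinfun.sum_left)
      \<comment> \<open>By localization the earlier functionals vanish at \<open>w n\<close>, which
        removes the term with the large factor \<open>4^n\<close>.\<close>
      also have "(\<Sum>i<n. \<phi> i (w n)) = 0"
        using ww w0 by (intro sum.neutral ballI \<phi>(4)) auto
      also have "\<Phi> (w n) \<le> norm \<Phi> * K"
      proof -
        have "\<Phi> (w n) \<le> norm \<Phi> * norm (w n)" using norm_blinfun[of \<Phi> "w n"] by simp
        also have "\<dots> \<le> norm \<Phi> * K" using nw by (intro mult_left_mono) auto
        finally show ?thesis .
      qed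
      also have "f n (w n) \<le> f n (pprt (u n))" by (intro nonneg_blinfun_mono f0 wu)
      \<comment> \<open>\<open>f n\<close> lies below \<open>\<phi> n\<close>, which vanishes at
        \<open>pprt (- u n)\<close> because that element is disjoint from \<open>w n\<close>; so the
        negative part of \<open>u n\<close> causes no cancellation.\<close>
      also have "f n (pprt (u n)) \<le> f n (u n)"
      proof -
        have "f n (pprt (- u n)) \<le> \<phi> n (pprt (- u n))" using f\<phi>[of n] by (simp add: less_eq_blinfun_def)
        also have "\<dots> = 0" by (intro \<phi>(4) uw) simp
        finally have "0 \<le> f n (nprt (u n))" by (simp add: pprt_neg blinfun.minus_right)
        moreover have "f n (u n) = f n (pprt (u n)) + f n (nprt (u n))"
          by (subst prts[of "u n"]) (rule blinfun.add_right)
        ultimately show ?thesis by simp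
      qed
      also have "f n (u n) \<le> \<bar>f n (T (y n))\<bar>" using u[of n] by (auto simp: blinfun.minus_right)
      finally show ?thesis using eu[of n] \<phi>(3)[of n] by (simp add: w_def)
    qed
    with lim have "e / 2 \<le> \<bar>0\<bar> + 0 * (norm \<Phi> * K)" by (intro LIMSEQ_le_const) auto
    with e show False by simp
  qed
qed

section \<open>Weak-star convergence of the moduli\<close>

text \<open>The strong operator topology is pulled back along \<open>blinfun_apply\<close> from the
  product topology, where convergence is coordinatewise.\<close>

lemma limitin_strong_operator_topology:
  "limitin strong_operator_topology f l F \<longleftrightarrow>
    (\<forall>x. ((\<lambda>n. blinfun_apply (f n) x) \<longlongrightarrow> blinfun_apply l x) F)"
proof
  assume "limitin strong_operator_topology f l F"
  from continuous_map_limit[OF strong_operator_topology_continuous_evaluation this]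
  show "\<forall>x. ((\<lambda>n. blinfun_apply (f n) x) \<longlongrightarrow> blinfun_apply l x) F" by (simp add: o_def)
next
  assume "\<forall>x. ((\<lambda>n. blinfun_apply (f n) x) \<longlongrightarrow> blinfun_apply l x) F"
  then have "limitin euclidean (\<lambda>n. blinfun_apply (f n)) (blinfun_apply l) F"
    unfolding euclidean_product_topology[symmetric] limitin_componentwise by simp
  then show "limitin strong_operator_topology f l F"
    by (auto simp: limitin_def strong_operator_topology_def openin_pullback_topology
        topspace_pullback_topology)
qed

text \<open>Since \<open>\<bar>g\<bar>\<close> is \<open>blinfun_pos (g + g) - g\<close>, the
  Riesz-Kantorovich formula makes \<open>\<bar>g\<bar> x\<close> the supremum of
  \<open>g (z + z - x)\<close> over \<open>z\<close> in \<open>{0..x}\<close>, and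
  \<open>z + z - x\<close> lies in \<open>{- x..x}\<close>.\<close>

lemma abs_blinfun_approx:
  fixes g :: "'a::banach_lattice \<Rightarrow>\<^sub>L real"
  assumes "0 \<le> x" "0 < \<eta>"
  obtains y where "y \<in> {- x..x}" "\<bar>g\<bar> x \<le> g y + \<eta>"
proof -
  have ab: "\<bar>g\<bar> x = rk_pos (g + g) x - g x"
    using assms(1) by (simp add: abs_blinfun_def sup_blinfun_def blinfun.add_left blinfun.diff_left
        blinfun_pos_apply)
  have "\<exists>z\<in>{0..x}. rk_pos (g + g) x \<le> (g + g) z + \<eta>"
  proof (rule ccontr)
    assume no: "\<not> ?thesis"
    have "rk_pos (g + g) x \<le> rk_pos (g + g) x - \<eta>"
    proof (rule rk_least[OF assms(1)])
      fix z assume "z \<in> {0..x}"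
      then have "(g + g) z + \<eta> \<le> rk_pos (g + g) x" using no by (meson nle_le)
      then show "(g + g) z \<le> rk_pos (g + g) x - \<eta>" by simp
    qed
    with assms(2) show False by simp
  qed
  then obtain z where z: "z \<in> {0..x}" "rk_pos (g + g) x \<le> (g + g) z + \<eta>" by blast
  have "z + z \<le> x + x" "- x \<le> - x + (z + z)"
    using z(1) by (auto intro: add_mono)
  then have "z + z - x \<in> {- x..x}" by (simp add: algebra_simps)
  moreover have "\<bar>g\<bar> x \<le> g (z + z - x) + \<eta>"
    using z(2) ab by (simp add: blinfun.diff_right blinfun.add_right blinfun.add_left)
  ultimately show thesis by (rule that)
qed

text \<open>This links (2) and (3) for a fixed \<open>f\<close>. An order bounded sequence is
  dominated in modulus by one positive element; conversely, near-maximizers for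
  \<open>\<bar>g n\<bar> x\<close> in \<open>{- x..x}\<close> form an order bounded
  sequence.\<close>

lemma abs_dual_adjoint_null_iff:
  fixes T :: "'e::banach_lattice \<Rightarrow>\<^sub>L 'f::banach_lattice"
  shows "limitin weak_star_topology (\<lambda>n. \<bar>dual_adjoint T (f n)\<bar>) 0 sequentially \<longleftrightarrow>
    (\<forall>x. order_bounded_seq x \<longrightarrow> (\<lambda>n. blinfun_apply (f n) (blinfun_apply T (x n))) \<longlonglongrightarrow> 0)"
    (is "?L \<longleftrightarrow> ?R")
proof
  define g where "g n = dual_adjoint T (f n)" for n
  have g: "blinfun_apply (g n) x = blinfun_apply (f n) (blinfun_apply T x)" for n x
    by (simp add: g_def dual_adjoint_def)
  have L: "?L \<longleftrightarrow> (\<forall>x. (\<lambda>n. \<bar>g n\<bar> x) \<longlonglongrightarrow> 0)"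
    by (simp add: limitin_strong_operator_topology g_def)
  show ?R if ?L
  proof (intro allI impI)
    fix x :: "nat \<Rightarrow> 'e" assume "order_bounded_seq x"
    then obtain a b where ab: "\<And>n. a \<le> x n" "\<And>n. x n \<le> b"
      by (fastforce simp: order_bounded_seq_def)
    have bound: "\<bar>x n\<bar> \<le> \<bar>a\<bar> + \<bar>b\<bar>" for n
    proof (rule abs_leI)
      show "x n \<le> \<bar>a\<bar> + \<bar>b\<bar>"
        using ab(2)[of n] abs_ge_self[of b] by (intro add_increasing) (auto intro: order_trans)
      have "- x n \<le> - a" using ab(1)[of n] by simp
      also have "\<dots> \<le> \<bar>a\<bar>" by (rule abs_ge_minus_self)
      finally show "- x n \<le> \<bar>a\<bar> + \<bar>b\<bar>" by (intro add_increasing2) auto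
    qed
    have "\<bar>g n (x n)\<bar> \<le> \<bar>g n\<bar> (\<bar>a\<bar> + \<bar>b\<bar>)" for n
      using abs_blinfun_le nonneg_blinfun_mono[OF abs_ge_zero bound] by (rule order_trans)
    moreover have "(\<lambda>n. \<bar>g n\<bar> (\<bar>a\<bar> + \<bar>b\<bar>)) \<longlonglongrightarrow> 0" using that L by blast
    ultimately have "(\<lambda>n. g n (x n)) \<longlonglongrightarrow> 0"
      by (intro Lim_null_comparison[of "\<lambda>n. g n (x n)" "\<lambda>n. \<bar>g n\<bar> (\<bar>a\<bar> + \<bar>b\<bar>)"]) auto
    then show "(\<lambda>n. blinfun_apply (f n) (blinfun_apply T (x n))) \<longlonglongrightarrow> 0" by (simp add: g)
  qed
  show ?L if R: ?R
    unfolding L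
  proof
    have pos: "(\<lambda>n. \<bar>g n\<bar> x) \<longlonglongrightarrow> 0" if x: "0 \<le> x" for x
    proof -
      have "\<exists>y. y \<in> {- x..x} \<and> \<bar>g n\<bar> x \<le> g n y + 1 / real (Suc n)" for n
        using abs_blinfun_approx[OF x, of "1 / real (Suc n)" "g n"] by (metis of_nat_0_less_iff zero_less_Suc zero_less_divide_1_iff)
      then obtain y where y: "\<And>n. y n \<in> {- x..x}" "\<And>n. \<bar>g n\<bar> x \<le> g n (y n) + 1 / real (Suc n)"
        by metis
      have "order_bounded_seq y" using y(1) unfolding order_bounded_seq_def by blast
      then have "(\<lambda>n. g n (y n)) \<longlonglongrightarrow> 0" using R by (simp add: g)
      moreover have "(\<lambda>n. 1 / real (Suc n)) \<longlonglongrightarrow> 0" by (rule LIMSEQ_Suc[OF lim_1_over_n])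
      ultimately have lim: "(\<lambda>n. g n (y n) + 1 / real (Suc n)) \<longlonglongrightarrow> 0" using tendsto_add by fastforce
      have "0 \<le> \<bar>g n\<bar> x" for n
        using x abs_ge_zero[of "g n"] unfolding less_eq_blinfun_def by simp
      then show ?thesis
        by (intro tendsto_sandwich[OF _ _ tendsto_const lim]) (use y(2) in auto)
    qed
    fix x
    have "(\<lambda>n. \<bar>g n\<bar> (pprt x) - \<bar>g n\<bar> (- nprt x)) \<longlonglongrightarrow> 0 - 0"
      by (intro tendsto_diff pos) auto
    moreover have "\<bar>g n\<bar> (pprt x) - \<bar>g n\<bar> (- nprt x) = \<bar>g n\<bar> x" for n
      using prts[of x] by (simp flip: blinfun.diff_right)
    ultimately show "(\<lambda>n. \<bar>g n\<bar> x) \<longlonglongrightarrow> 0" by simp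
  qed
qed

theorem theorem2p1:
  fixes T :: "'e::banach_lattice \<Rightarrow>\<^sub>L 'f::banach_lattice"
  shows "(order_L_weakly_compact T \<longleftrightarrow>
      (\<forall>f :: nat \<Rightarrow> ('f \<Rightarrow>\<^sub>L real). disjoint_seq f \<and> range f \<subseteq> cball 0 1 \<longrightarrow>
        limitin weak_star_topology (\<lambda>n. \<bar>dual_adjoint T (f n)\<bar>) 0 sequentially)) \<and>
    (order_L_weakly_compact T \<longleftrightarrow>
      (\<forall>(x :: nat \<Rightarrow> 'e) (f :: nat \<Rightarrow> ('f \<Rightarrow>\<^sub>L real)).
        order_bounded_seq x \<and> disjoint_seq f \<and> range f \<subseteq> cball 0 1 \<longrightarrow>
        (\<lambda>n. blinfun_apply (f n) (blinfun_apply T (x n))) \<longlonglongrightarrow> 0))"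
  \<comment> \<open>After the rewriting, (2) and (3) differ only in how the quantifiers over
    \<open>x\<close> and \<open>f\<close> are arranged.\<close>
  unfolding abs_dual_adjoint_null_iff
  using order_L_weakly_compact_imp_null[of T] order_L_weakly_compactI[of T] by blast

end
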